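(* Let $d\ge 1$, let $T=\{t_1<\dots<t_{d+1}\}$ be a set of $d+1$ integers, and let $m$ be a positive integer. Then $\mathrm{Vol}(m\,C_d(T))=|\mathcal{L}(\Omega(m\,C_d(T)))|$.
   Context: $\nu_d(t)=(t,t^2,\dots,t^d)^T$; $C_d(T)=\mathrm{conv}\{\nu_d(t_1),\dots,\nu_d(t_{d+1})\}$; $mP=\{mx:x\in P\}$; $\mathrm{Vol}$ is $d$-dimensional volume; $\mathcal{L}(R)=R\cap\mathbb{Z}^d$. With $\pi:\mathbb{R}^d\to\mathbb{R}^{d-1}$ forgetting the last coordinate, for $y\in\pi(P)$ let $n(y,P)$ be the point of $\pi^{-1}(y)\cap P$ with smallest last coordinate; $NB(P)=\bigcup_{y\in\pi(P)}n(y,P)$ and $\Omega(P)=P\setminus NB(P)$. *)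

theory Defs
  imports "HOL-Analysis.Analysis"
begin

text \<open>
  The space \<open>\<real>\<^sup>d\<close> is \<^typ>\<open>real ^ 'd\<close> with \<open>d = CARD('d)\<close>. The linear order on the index type
  lists the coordinates: index \<open>i\<close> is coordinate number \<open>card {..i}\<close>, which runs
  through \<open>1, \<dots>, d\<close>, and \<open>Max UNIV\<close> is the last one.
\<close>

definition last_coord :: "'d::{finite,linorder}" where
  "last_coord = Max UNIV"

definition moment_curve :: "real \<Rightarrow> real ^ 'd::{finite,linorder}" where
  "moment_curve t = (\<chi> i. t ^ card {..i})"

definition cyclic_polytope :: "int set \<Rightarrow> (real ^ 'd::{finite,linorder}) set" where
  "cyclic_polytope T = convex hull ((\<lambda>t. moment_curve (real_of_int t)) ` T)"

definition dilate :: "nat \<Rightarrow> 'a::real_vector set \<Rightarrow> 'a set" where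
  "dilate m P = (\<lambda>x. real m *\<^sub>R x) ` P"

definition lattice_points :: "(real ^ 'd::finite) set \<Rightarrow> (real ^ 'd) set" where
  "lattice_points R = R \<inter> {x. \<forall>i. x $ i \<in> \<int>}"

text \<open>
  The target \<open>\<real>\<^sup>d\<^sup>-\<^sup>1\<close> of the projection is rendered as the functions on the non-last
  indices, extended by \<open>undefined\<close>; for \<open>d = 1\<close> it is a single point.
\<close>

definition forget_last :: "real ^ 'd::{finite,linorder} \<Rightarrow> ('d::{finite,linorder} \<Rightarrow> real)" where
  "forget_last x = restrict (\<lambda>i. x $ i) (- {last_coord})"

text \<open>
  A point of a fibre is determined by its last coordinate, so the choice made by
  \<^const>\<open>arg_min\<close> is unique whenever the minimum exists, in particular for compact \<open>P\<close>
  and \<open>y \<in> forget_last ` P\<close>.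
\<close>

definition lowest_point ::
    "('d::{finite,linorder} \<Rightarrow> real) \<Rightarrow> (real ^ 'd::{finite,linorder}) set \<Rightarrow> real ^ 'd::{finite,linorder}" where
  "lowest_point y P = (ARG_MIN (\<lambda>x. x $ last_coord) x. x \<in> forget_last -` {y} \<inter> P)"

definition negative_boundary ::
    "(real ^ 'd::{finite,linorder}) set \<Rightarrow> (real ^ 'd::{finite,linorder}) set" where
  "negative_boundary P = (\<Union>y \<in> forget_last ` P. {lowest_point y P})"

definition nonneg_part :: "(real ^ 'd::{finite,linorder}) set \<Rightarrow> (real ^ 'd::{finite,linorder}) set" where
  "nonneg_part P = P - negative_boundary P"

end

theory Submission imports Defs "HOL-Computational_Algebra.Polynomial" begin

text \<open>
  A point of the dilated simplex is the vector of moments \<open>1, \<dots>, d\<close> of a nonnegative measure of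
  total mass \<open>m\<close> on \<open>T\<close>. Multiplying the measure by \<open>t - j\<close> for a node \<open>j\<close> is an integral unipotent
  map on moments that kills the mass at \<open>j\<close>. The simplex is a signed sum of cones at its vertices
  whose edges point in the direction of increasing first coordinate, and the slice of the cone at
  \<open>j\<close> by \<open>x\<^sub>1 = k\<close> is mapped by that multiplication onto the simplex with nodes \<open>T - {j}\<close> and mass
  \<open>k - j m\<close>, one dimension lower, with the lower boundary again removed. By induction every slice
  contributes a multiple of \<open>(k - j m)\<^sup>d\<^sup>-\<^sup>1\<close>; summing over \<open>k\<close> gives a polynomial of degree \<open>d\<close> in
  \<open>j\<close>, and the signed sum over \<open>j\<close> is its divided difference, which only sees the leading
  coefficient. The result is the Vandermonde determinant times \<open>m\<^sup>d / d!\<close>, the volume.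
\<close>

section \<open>Moments and Lagrange interpolation\<close>

text \<open>If \<open>x\<close> lists the moments of a signed measure, this is the integral of
  \<open>p\<close> against it.\<close>

definition moment_functional :: "(nat \<Rightarrow> real) \<Rightarrow> real poly \<Rightarrow> real" where
  "moment_functional x p = (\<Sum>i\<le>degree p. coeff p i * x i)"

text \<open>The Lagrange basis polynomial at \<open>s\<close> before division by its value
  \<open>node_diff T s\<close> there. It is left monic, which makes leading coefficients easy to
  compare later.\<close>

definition node_poly :: "real set \<Rightarrow> real \<Rightarrow> real poly" where
  "node_poly T s = (\<Prod>r\<in>T - {s}. [:- r, 1:])"

definition node_diff :: "real set \<Rightarrow> real \<Rightarrow> real" where
  "node_diff T s = (\<Prod>r\<in>T - {s}. s - r)"

definition weight :: "real set \<Rightarrow> real \<Rightarrow> (nat \<Rightarrow> real) \<Rightarrow> real" where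
  "weight T s x = moment_functional x (node_poly T s)"

lemma moment_functional_eq:
  assumes "degree p \<le> n"
  shows "moment_functional x p = (\<Sum>i\<le>n. coeff p i * x i)"
  unfolding moment_functional_def
  by (rule sum.mono_neutral_left) (use assms in \<open>auto simp: coeff_eq_0\<close>)

lemma moment_functional_add:
  "moment_functional x (p + q) = moment_functional x p + moment_functional x q"
proof -
  let ?n = "max (degree p) (degree q)"
  have "degree (p + q) \<le> ?n" by (simp add: degree_add_le)
  then show ?thesis
    using moment_functional_eq[of p ?n x] moment_functional_eq[of q ?n x]
      moment_functional_eq[of "p + q" ?n x]
    by (simp add: sum.distrib algebra_simps)
qed

lemma moment_functional_smult:
  "moment_functional x (smult c p) = c * moment_functional x p"
  using moment_functional_eq[of "smult c p" "degree p" x] moment_functional_eq[of p "degree p" x]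
  by (simp add: sum_distrib_left mult.assoc degree_smult_le)

lemma moment_functional_sum:
  "moment_functional x (\<Sum>s\<in>S. f s) = (\<Sum>s\<in>S. moment_functional x (f s))"
proof (induction S rule: infinite_finite_induct)
  case (insert a S)
  then show ?case by (simp add: moment_functional_add)
qed (simp_all add: moment_functional_def)

lemma moment_functional_pCons:
  "moment_functional x (pCons a p) = a * x 0 + moment_functional (\<lambda>i. x (Suc i)) p"
proof -
  have "degree (pCons a p) \<le> Suc (degree p)" by (rule degree_pCons_le)
  then have "moment_functional x (pCons a p) = (\<Sum>i\<le>Suc (degree p). coeff (pCons a p) i * x i)"
    by (rule moment_functional_eq)
  also have "\<dots> = a * x 0 + (\<Sum>i\<le>degree p. coeff p i * x (Suc i))"
    by (simp del: sum.atMost_Suc add: sum.atMost_Suc_shift)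
  finally show ?thesis by (simp add: moment_functional_def)
qed

lemma moment_functional_one [simp]: "moment_functional x 1 = x 0"
  by (simp add: moment_functional_def)

lemma moment_functional_monom: "moment_functional x (monom c n) = c * x n"
proof -
  have "moment_functional x (monom c n) = (\<Sum>i\<le>n. coeff (monom c n) i * x i)"
    by (rule moment_functional_eq) (rule degree_monom_le)
  also have "\<dots> = (\<Sum>i\<in>{n}. coeff (monom c n) i * x i)"
    by (rule sum.mono_neutral_right) auto
  finally show ?thesis by simp
qed

lemma moment_functional_cong:
  assumes "degree p < n" "\<And>i. i < n \<Longrightarrow> x i = y i"
  shows "moment_functional x p = moment_functional y p"
  unfolding moment_functional_def by (rule sum.cong) (use assms in auto)

lemma moment_functional_power:
  "moment_functional (\<lambda>i. t ^ i) p = poly p t"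
  by (simp add: moment_functional_def poly_altdef)

lemma moment_functional_linear_args:
  "moment_functional (\<lambda>i. a * x i + b * y i) p = a * moment_functional x p + b * moment_functional y p"
  by (simp add: moment_functional_def algebra_simps sum.distrib sum_distrib_left)

lemma prod_linear_monic:
  fixes f :: "'i \<Rightarrow> real"
  shows "degree (\<Prod>i\<in>S. [:f i, 1:]) = card S" and "coeff (\<Prod>i\<in>S. [:f i, 1:]) (card S) = 1"
proof -
  have "degree (\<Prod>i\<in>S. [:f i, 1:]) = card S \<and> lead_coeff (\<Prod>i\<in>S. [:f i, 1:]) = 1"
  proof (induction S rule: infinite_finite_induct)
    case (insert a S)
    then have nz: "(\<Prod>i\<in>S. [:f i, 1:]) \<noteq> 0" by fastforce
    have "degree ([:f a, 1:] * (\<Prod>i\<in>S. [:f i, 1:])) = Suc (card S)"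
      using insert nz by (subst degree_mult_eq) auto
    moreover have "lead_coeff ([:f a, 1:] * (\<Prod>i\<in>S. [:f i, 1:])) = 1"
      by (simp only: lead_coeff_mult conjunct2[OF insert.IH]) simp
    ultimately show ?case using insert by (simp del: mult_pCons_left)
  qed auto
  then show "degree (\<Prod>i\<in>S. [:f i, 1:]) = card S" "coeff (\<Prod>i\<in>S. [:f i, 1:]) (card S) = 1"
    by auto
qed

lemma degree_node_poly: "s \<in> T \<Longrightarrow> degree (node_poly T s) = card T - 1"
  using prod_linear_monic(1)[of uminus "T - {s}"] by (cases "finite T") (auto simp: node_poly_def)

lemma degree_node_poly_less: "finite T \<Longrightarrow> s \<in> T \<Longrightarrow> degree (node_poly T s) < card T"
  using degree_node_poly[of s T] card_gt_0_iff[of T] by auto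

lemma coeff_node_poly: "s \<in> T \<Longrightarrow> coeff (node_poly T s) (card T - 1) = 1"
  using prod_linear_monic(2)[of uminus "T - {s}"] by (cases "finite T") (auto simp: node_poly_def)

lemma poly_node_poly: "poly (node_poly T s) t = (\<Prod>r\<in>T - {s}. t - r)"
  by (simp add: node_poly_def poly_prod)

lemma poly_node_poly_self: "poly (node_poly T s) s = node_diff T s"
  by (simp add: poly_node_poly node_diff_def)

lemma poly_node_poly_other: "finite T \<Longrightarrow> t \<in> T \<Longrightarrow> t \<noteq> s \<Longrightarrow> poly (node_poly T s) t = 0"
  by (auto simp: poly_node_poly prod_zero_iff)

lemma node_diff_nonzero: "finite T \<Longrightarrow> node_diff T s \<noteq> 0"
  by (auto simp: node_diff_def prod_zero_iff)

text \<open>The difference of the two sides has degree below \<open>card T\<close> but vanishes at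
  all nodes.\<close>

lemma lagrange_interpolation:
  assumes "finite T" "degree q < card T"
  shows "q = (\<Sum>s\<in>T. smult (poly q s / node_diff T s) (node_poly T s))" (is "_ = ?p")
proof (rule ccontr)
  assume ne: "q \<noteq> ?p"
  have "degree ?p \<le> card T - 1"
    by (intro degree_sum_le) (use assms degree_node_poly in \<open>auto intro: order.trans[OF degree_smult_le]\<close>)
  then have deg: "degree (q - ?p) \<le> card T - 1"
    using assms by (intro degree_diff_le) auto
  have "poly ?p t = poly q t" if "t \<in> T" for t
  proof -
    have "poly ?p t = (\<Sum>s\<in>T. poly q s / node_diff T s * poly (node_poly T s) t)"
      by (simp add: poly_sum)
    also have "\<dots> = (\<Sum>s\<in>{t}. poly q s / node_diff T s * poly (node_poly T s) t)"
      by (rule sum.mono_neutral_right) (use assms that poly_node_poly_other in auto)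
    also have "\<dots> = poly q t"
      using node_diff_nonzero[OF assms(1)] by (simp add: poly_node_poly_self)
    finally show ?thesis .
  qed
  then have "T \<subseteq> {t. poly (q - ?p) t = 0}" by auto
  moreover have "q - ?p \<noteq> 0" using ne by simp
  ultimately have "card T \<le> degree (q - ?p)"
    using card_poly_roots_bound[of "q - ?p"] poly_roots_finite[of "q - ?p"] card_mono order.trans by blast
  then show False using deg assms by linarith
qed

lemma moment_functional_lagrange:
  assumes "finite T" "degree q < card T"
  shows "moment_functional x q = (\<Sum>s\<in>T. poly q s * (weight T s x / node_diff T s))"
  by (subst lagrange_interpolation[OF assms])
    (simp add: moment_functional_sum moment_functional_smult weight_def)

text \<open>Compare coefficients of degree \<open>card T - 1\<close> in Lagrange's formula, where
  the node polynomials are monic. The left side is the divided difference of \<open>q\<close> on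
  \<open>T\<close>.\<close>

lemma sum_divided_difference:
  assumes "finite T" "degree q < card T"
  shows "(\<Sum>s\<in>T. poly q s / node_diff T s) = coeff q (card T - 1)"
proof -
  have "coeff q (card T - 1)
      = (\<Sum>s\<in>T. poly q s / node_diff T s * coeff (node_poly T s) (card T - 1))"
    by (subst lagrange_interpolation[OF assms]) (simp add: coeff_sum)
  also have "\<dots> = (\<Sum>s\<in>T. poly q s / node_diff T s)"
    by (rule sum.cong) (auto simp: coeff_node_poly simp del: One_nat_def)
  finally show ?thesis by simp
qed

section \<open>Products of node differences\<close>

lemma node_diff_insert:
  assumes "finite T" "b \<notin> T" "s \<in> T"
  shows "node_diff (insert b T) s = (s - b) * node_diff T s"
proof -
  have "insert b T - {s} = insert b (T - {s})" using assms by auto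
  then show ?thesis using assms by (simp add: node_diff_def)
qed

lemma node_diff_remove:
  assumes "finite T" "j \<in> T" "s \<in> T" "s \<noteq> j"
  shows "node_diff T s = (s - j) * node_diff (T - {j}) s"
  using node_diff_insert[of "T - {j}" j s] assms by (simp add: insert_absorb)

lemma node_diff_max_pos: "(\<And>s. s \<in> T \<Longrightarrow> s \<le> b) \<Longrightarrow> node_diff T b > 0"
  unfolding node_diff_def by (rule prod_pos) (auto simp: less_le)

lemma node_poly_remove:
  assumes "finite T" "j \<in> T" "s \<in> T" "s \<noteq> j"
  shows "node_poly T s = [:- j, 1:] * node_poly (T - {j}) s"
proof -
  have "T - {s} = insert j (T - {j} - {s})" using assms by auto
  then show ?thesis using assms by (simp add: node_poly_def del: mult_pCons_left)
qed

text \<open>In the product of all \<open>\<bar>node_diff T s\<bar>\<close> every pair of nodes occurs twice, hence the square root.\<close>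
definition vandermonde :: "real set \<Rightarrow> real" where
  "vandermonde T = sqrt (\<Prod>s\<in>T. \<bar>node_diff T s\<bar>)"

text \<open>Under the root \<open>node_diff T j\<close> occurs squared: once as the factor of
  \<open>j\<close>, once spread over the other nodes as their factors \<open>s - j\<close>.\<close>

lemma vandermonde_remove:
  assumes "finite T" "j \<in> T"
  shows "vandermonde T = \<bar>node_diff T j\<bar> * vandermonde (T - {j})"
proof -
  have "(\<Prod>s\<in>T. \<bar>node_diff T s\<bar>) = \<bar>node_diff T j\<bar> * (\<Prod>s\<in>T - {j}. \<bar>node_diff T s\<bar>)"
    using assms by (simp add: prod.remove)
  also have "(\<Prod>s\<in>T - {j}. \<bar>node_diff T s\<bar>)
      = (\<Prod>s\<in>T - {j}. \<bar>j - s\<bar> * \<bar>node_diff (T - {j}) s\<bar>)"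
    using node_diff_remove[OF assms] by (intro prod.cong) (auto simp: abs_mult abs_minus_commute)
  also have "\<dots> = \<bar>node_diff T j\<bar> * (\<Prod>s\<in>T - {j}. \<bar>node_diff (T - {j}) s\<bar>)"
    by (simp add: prod.distrib node_diff_def abs_prod)
  finally show ?thesis
    by (simp add: vandermonde_def real_sqrt_mult)
qed

lemma vandermonde_singleton [simp]: "vandermonde {t} = 1"
  by (simp add: vandermonde_def node_diff_def)

text \<open>The largest node is split off at each step; all its differences are positive, so the
  absolute values disappear.\<close>

lemma vandermonde_image:
  fixes t :: "nat \<Rightarrow> real"
  assumes "strict_mono_on {..n} t"
  shows "vandermonde (t ` {..n}) = (\<Prod>k\<le>n. \<Prod>i<k. t k - t i)"
  using assms
proof (induction n)
  case (Suc n)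
  let ?j = "t (Suc n)"
  have mono: "strict_mono_on {..n} t"
    using Suc.prems by (rule monotone_on_subset) auto
  have less: "t i < ?j" if "i \<le> n" for i
    using Suc.prems that by (intro strict_mono_onD[OF Suc.prems]) auto
  then have remove: "t ` {..Suc n} - {?j} = t ` {..n}" by (force simp: atMost_Suc)
  have inj: "inj_on t {..n}" using mono by (rule strict_mono_on_imp_inj_on)
  have "node_diff (t ` {..Suc n}) ?j = (\<Prod>i\<le>n. ?j - t i)"
    unfolding node_diff_def remove using inj by (simp add: prod.reindex)
  moreover have "(\<Prod>i\<le>n. ?j - t i) > 0" using less by (intro prod_pos) auto
  ultimately show ?case
    using vandermonde_remove[of "t ` {..Suc n}" ?j] Suc.IH[OF mono]
    by (simp add: remove lessThan_Suc_atMost mult.commute)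
qed simp

section \<open>Power sums\<close>

text \<open>Rising factorials, the basis in which a backward difference just lowers the
  index.\<close>

definition rising_poly :: "nat \<Rightarrow> real poly" where
  "rising_poly k = (\<Prod>i<k. [:real i, 1:])"

lemma degree_rising_poly: "degree (rising_poly k) = k"
  using prod_linear_monic(1)[of real "{..<k}"] by (simp add: rising_poly_def)

lemma coeff_rising_poly: "coeff (rising_poly k) k = 1"
  using prod_linear_monic(2)[of real "{..<k}"] by (simp add: rising_poly_def)

lemma poly_rising_poly: "poly (rising_poly k) x = pochhammer x k"
  by (simp add: rising_poly_def poly_prod pochhammer_prod add.commute atLeast0LessThan)

lemma pochhammer_diff:
  fixes x :: real
  shows "pochhammer (x + 1) (Suc k) - pochhammer x (Suc k) = real (Suc k) * pochhammer (x + 1) k"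
  unfolding pochhammer_rec[of x] pochhammer_rec'[of "x + 1"] by (simp add: algebra_simps)

text \<open>Induction on the degree bound: the leading term is removed with a rising factorial,
  whose antidifference is the next rising factorial divided by its degree. The argument
  \<open>x + 1\<close> on the right suits sums that start at 1.\<close>

lemma indefinite_sum_poly_exists:
  assumes "degree q \<le> e"
  shows "\<exists>p::real poly. degree p \<le> Suc e \<and> coeff p (Suc e) = coeff q e / real (Suc e)
    \<and> poly p 0 = 0 \<and> (\<forall>x. poly p (x + 1) - poly p x = poly q (x + 1))"
  using assms
proof (induction e arbitrary: q)
  case 0
  then obtain a where "q = [:a:]" by (auto elim: degree_eq_zeroE)
  then show ?case
    by (intro exI[of _ "[:0, a:]"]) (auto simp: algebra_simps)
next
  case (Suc e)
  define c where "c = coeff q (Suc e)"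
  have "degree (q - smult c (rising_poly (Suc e))) \<le> e"
  proof (rule degree_le, intro allI impI)
    fix i assume "e < i"
    then consider "i = Suc e" | "Suc e < i" by linarith
    then show "coeff (q - smult c (rising_poly (Suc e))) i = 0"
    proof cases
      case 1
      then show ?thesis by (simp add: c_def coeff_rising_poly)
    next
      case 2
      then show ?thesis
        using Suc.prems by (simp add: coeff_eq_0 degree_rising_poly)
    qed
  qed
  from Suc.IH[OF this] obtain p where p: "degree p \<le> Suc e" "poly p 0 = 0"
    "\<And>x. poly p (x + 1) - poly p x = poly q (x + 1) - c * pochhammer (x + 1) (Suc e)"
    by (auto simp: poly_rising_poly)
  define p' where "p' = p + smult (c / real (Suc (Suc e))) (rising_poly (Suc (Suc e)))"
  have "degree p' \<le> Suc (Suc e)"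
    unfolding p'_def using p(1)
    by (intro degree_add_le order.trans[OF degree_smult_le]) (auto simp: degree_rising_poly)
  moreover have "coeff p' (Suc (Suc e)) = c / real (Suc (Suc e))"
    using p(1) by (simp add: p'_def coeff_rising_poly coeff_eq_0)
  moreover have "poly p' 0 = 0"
    by (simp add: p'_def p(2) poly_rising_poly pochhammer_rec)
  moreover have "poly p' (x + 1) - poly p' x = poly q (x + 1)" for x
  proof -
    have "poly p' (x + 1) - poly p' x = poly p (x + 1) - poly p x
        + c / real (Suc (Suc e)) * (pochhammer (x + 1) (Suc (Suc e)) - pochhammer x (Suc (Suc e)))"
      unfolding p'_def poly_add poly_smult poly_rising_poly by (simp only: algebra_simps)
    also have "\<dots> = poly q (x + 1)"
      unfolding pochhammer_diff p(3) by (simp add: field_simps)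
    finally show ?thesis .
  qed
  ultimately show ?case unfolding c_def by blast
qed

text \<open>Faulhaber's polynomial; only its degree and leading coefficient survive in the final
  count.\<close>

lemma power_sum_poly_exists:
  "\<exists>p::real poly. degree p \<le> Suc e \<and> coeff p (Suc e) = 1 / real (Suc e)
    \<and> (\<forall>n. poly p (real n) = (\<Sum>i=1..n. real i ^ e))"
proof -
  obtain p :: "real poly" where p: "degree p \<le> Suc e" "coeff p (Suc e) = 1 / real (Suc e)"
    "poly p 0 = 0" "\<And>x. poly p (x + 1) - poly p x = (x + 1) ^ e"
    using indefinite_sum_poly_exists[of "monom 1 e" e]
    by (auto simp: degree_monom_le poly_monom)
  have "poly p (real n) = (\<Sum>i=1..n. real i ^ e)" for n
  proof (induction n)
    case (Suc n)
    then show ?case using p(4)[of "real n"] by (simp add: algebra_simps)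
  qed (simp add: p(3))
  then show ?thesis using p(1,2) by blast
qed

section \<open>Counting integral moment sequences\<close>

text \<open>
  With \<open>c s\<close> saying that the mass at \<open>s\<close> is positive, this is the cone at the vertex of \<open>j\<close>
  whose edges all point in the direction of increasing first coordinate.
\<close>
definition flip_region :: "real set \<Rightarrow> (real \<Rightarrow> bool) \<Rightarrow> real \<Rightarrow> bool" where
  "flip_region T c j \<longleftrightarrow> (\<forall>s\<in>T. (j < s \<longrightarrow> c s) \<and> (s < j \<longrightarrow> \<not> c s))"

text \<open>
  \<open>flip_region T c j\<close> holds only for patterns \<open>c\<close> that are false up to some point and true from then
  on; every such pattern, unless constant, lies in exactly two neighbouring regions, which cancel.
\<close>
lemma sum_flip_region:
  assumes "finite T"
  shows "(\<Sum>j\<in>T. sgn (node_diff T j) * of_bool (flip_region T c j))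
    = of_bool (\<forall>s\<in>T. \<not> c s) - (- 1) ^ card T * of_bool (\<forall>s\<in>T. c s)"
  using assms
proof (induction T rule: finite_linorder_max_induct)
  case (insert b A)
  then have b: "b \<notin> A" by auto
  \<comment> \<open>The new largest node \<open>b\<close> gives every smaller \<open>j\<close> the
    negative factor \<open>j - b\<close> and adds the requirement \<open>c b\<close> to its
    region.\<close>
  have 1: "sgn (node_diff (insert b A) j) * of_bool (flip_region (insert b A) c j)
      = - of_bool (c b) * (sgn (node_diff A j) * of_bool (flip_region A c j))" if "j \<in> A" for j
  proof -
    have "j < b" using that insert by auto
    then have "sgn (node_diff (insert b A) j) = - sgn (node_diff A j)"
      using node_diff_insert[OF \<open>finite A\<close> b that] by (simp add: sgn_mult)
    moreover have "flip_region (insert b A) c j \<longleftrightarrow> c b \<and> flip_region A c j"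
      using \<open>j < b\<close> by (auto simp: flip_region_def)
    ultimately show ?thesis by simp
  qed
  have "node_diff (insert b A) b > 0"
    by (rule node_diff_max_pos) (use insert in auto)
  then have 2: "sgn (node_diff (insert b A) b) = 1" by simp
  have 3: "flip_region (insert b A) c b \<longleftrightarrow> (\<forall>s\<in>A. \<not> c s)"
    using insert by (auto simp: flip_region_def)
  show ?case
  proof -
    have "(\<Sum>j\<in>insert b A. sgn (node_diff (insert b A) j) * of_bool (flip_region (insert b A) c j))
        = of_bool (\<forall>s\<in>A. \<not> c s)
          - of_bool (c b) * (\<Sum>j\<in>A. sgn (node_diff A j) * of_bool (flip_region A c j))"
    proof -
      have "(\<Sum>j\<in>A. sgn (node_diff (insert b A) j) * of_bool (flip_region (insert b A) c j))
          = - of_bool (c b) * (\<Sum>j\<in>A. sgn (node_diff A j) * of_bool (flip_region A c j))"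
        unfolding sum_distrib_left by (rule sum.cong[OF refl 1])
      then show ?thesis
        unfolding sum.insert[OF insert.hyps(1) b] 2 3 by simp
    qed
    also have "\<dots> = of_bool (\<forall>s\<in>A. \<not> c s)
          - of_bool (c b) * (of_bool (\<forall>s\<in>A. \<not> c s) - (- 1) ^ card A * of_bool (\<forall>s\<in>A. c s))"
      by (simp only: insert.IH)
    also have "\<dots> = of_bool (\<forall>s\<in>insert b A. \<not> c s)
          - (- 1) ^ card (insert b A) * of_bool (\<forall>s\<in>insert b A. c s)"
      using insert.hyps b by (cases "c b") auto
    finally show ?thesis .
  qed
qed simp

text \<open>
  The quotient \<open>weight T s x / node_diff T s\<close> is the mass at \<open>s\<close> of the signed measure on \<open>T\<close> with
  moments \<open>x\<close>. The condition below asks it to be positive if \<open>node_diff T s > 0\<close> (facets on the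
  lower boundary, which is removed) and nonnegative if \<open>node_diff T s < 0\<close>.
\<close>
abbreviation same_sign :: "real set \<Rightarrow> (nat \<Rightarrow> real) \<Rightarrow> real \<Rightarrow> bool" where
  "same_sign T x s \<equiv> (0 < weight T s x \<longleftrightarrow> 0 < node_diff T s)"

text \<open>Entry 0 is the total mass. Entries from \<open>n\<close> on are zero, so that each
  vector of moments is exactly one function.\<close>

definition int_moments :: "nat \<Rightarrow> real \<Rightarrow> (nat \<Rightarrow> real) set" where
  "int_moments n m = {x. x 0 = m \<and> range x \<subseteq> \<int> \<and> (\<forall>i\<ge>n. x i = 0)}"

text \<open>The mass \<open>m\<close> may be any real, since the recursion produces masses
  \<open>k - j * m\<close> of either sign.\<close>

definition simplex_moments :: "real set \<Rightarrow> real \<Rightarrow> (nat \<Rightarrow> real) set" where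
  "simplex_moments T m = {x \<in> int_moments (card T) m. \<forall>s\<in>T. same_sign T x s}"

definition cone_slice :: "real set \<Rightarrow> real \<Rightarrow> real \<Rightarrow> real \<Rightarrow> (nat \<Rightarrow> real) set" where
  "cone_slice T m j k = {x \<in> int_moments (card T) m. x 1 = k \<and> flip_region T (same_sign T x) j}"

text \<open>The moments of the measure multiplied by \<open>t - j\<close>, cut off after
  \<open>n\<close> entries.\<close>

definition shift_moments :: "real \<Rightarrow> nat \<Rightarrow> (nat \<Rightarrow> real) \<Rightarrow> nat \<Rightarrow> real" where
  "shift_moments j n x i = (if i < n then x (Suc i) - j * x i else 0)"

lemma moment_functional_linear_factor:
  "moment_functional x ([:- j, 1:] * p) = moment_functional (\<lambda>i. x (Suc i) - j * x i) p"
proof -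
  have "[:- j, 1:] * p = smult (- j) p + pCons 0 p" by simp
  then have "moment_functional x ([:- j, 1:] * p)
      = - j * moment_functional x p + moment_functional (\<lambda>i. x (Suc i)) p"
    by (simp only: moment_functional_add moment_functional_smult moment_functional_pCons)
  then show ?thesis
    using moment_functional_linear_args[of 1 "\<lambda>i. x (Suc i)" "- j" x p] by simp
qed

text \<open>The node polynomial of \<open>T\<close> at \<open>s\<close> is \<open>t - j\<close>
  times that of \<open>T - {j}\<close>, and the factor may be moved from the polynomial to the
  measure.\<close>

lemma weight_shift_moments:
  assumes "finite T" "j \<in> T" "s \<in> T" "s \<noteq> j"
  shows "weight (T - {j}) s (shift_moments j (card T - 1) x) = weight T s x"
proof -
  have "weight T s x = moment_functional (\<lambda>i. x (Suc i) - j * x i) (node_poly (T - {j}) s)"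
    by (simp only: weight_def node_poly_remove[OF assms] moment_functional_linear_factor)
  also have "\<dots> = weight (T - {j}) s (shift_moments j (card T - 1) x)"
    unfolding weight_def
  proof (rule moment_functional_cong)
    show "degree (node_poly (T - {j}) s) < card T - 1"
      using degree_node_poly_less[of "T - {j}" s] assms by simp
  qed (simp add: shift_moments_def)
  finally show ?thesis by simp
qed

text \<open>The weight is unchanged while \<open>node_diff\<close> loses the factor
  \<open>s - j\<close>, so the condition is negated exactly at nodes below \<open>j\<close>. Strict
  and weak inequalities trade places there, so half-open facets match.\<close>

lemma same_sign_shift_moments:
  assumes "finite T" "j \<in> T" "s \<in> T" "s \<noteq> j"
  shows "same_sign (T - {j}) (shift_moments j (card T - 1) x) s
    \<longleftrightarrow> (if j < s then same_sign T x s else \<not> same_sign T x s)"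
proof (cases "j < s")
  case True
  then show ?thesis
    unfolding weight_shift_moments[OF assms] node_diff_remove[OF assms] by (simp add: zero_less_mult_iff)
next
  case False
  then have "0 < node_diff T s \<longleftrightarrow> \<not> 0 < node_diff (T - {j}) s"
    unfolding node_diff_remove[OF assms]
    using assms node_diff_nonzero[of "T - {j}" s] by (simp add: zero_less_mult_iff not_less le_less)
  with False show ?thesis
    unfolding weight_shift_moments[OF assms] by simp
qed

lemma flip_region_shift_moments:
  assumes "finite T" "j \<in> T"
  shows "flip_region T (same_sign T x) j
    \<longleftrightarrow> (\<forall>s\<in>T - {j}. same_sign (T - {j}) (shift_moments j (card T - 1) x) s)"
proof -
  have "((j < s \<longrightarrow> same_sign T x s) \<and> (s < j \<longrightarrow> \<not> same_sign T x s))
      \<longleftrightarrow> (s \<noteq> j \<longrightarrow> same_sign (T - {j}) (shift_moments j (card T - 1) x) s)" if "s \<in> T" for s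
    using same_sign_shift_moments[OF assms that, of x] by (cases s j rule: linorder_cases) simp_all
  then show ?thesis unfolding flip_region_def by blast
qed

text \<open>With \<open>x 0 = m\<close> fixed, the recursion
  \<open>x (Suc i) = y i + j * x i\<close> has one solution, integral because \<open>j\<close> is.
  The new mass is \<open>y 0 = x 1 - j * x 0 = k - j * m\<close>.\<close>

lemma bij_betw_cone_slice:
  assumes "finite T" "j \<in> T" "card T \<ge> 2" "j \<in> \<int>" "m \<in> \<int>"
  shows "bij_betw (shift_moments j (card T - 1)) (cone_slice T m j k)
    (simplex_moments (T - {j}) (k - j * m))"
proof -
  define n where "n = card T"
  have n: "n \<ge> 2" and card: "card (T - {j}) = n - 1"
    using assms by (auto simp: n_def)
  show ?thesis
    unfolding bij_betw_def n_def[symmetric]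
  proof (intro conjI subset_antisym subsetI)
    show "inj_on (shift_moments j (n - 1)) (cone_slice T m j k)"
    proof (rule inj_onI, rule ext)
      fix x y i
      assume x: "x \<in> cone_slice T m j k" and y: "y \<in> cone_slice T m j k"
        and eq: "shift_moments j (n - 1) x = shift_moments j (n - 1) y"
      show "x i = y i"
      proof (induction i)
        case 0
        then show ?case using x y by (simp add: cone_slice_def int_moments_def)
      next
        case (Suc i)
        show ?case
        proof (cases "Suc i < n")
          case True
          then show ?thesis using fun_cong[OF eq, of i] Suc n
            by (simp add: shift_moments_def less_diff_conv)
        next
          case False
          then show ?thesis using x y by (simp add: cone_slice_def int_moments_def n_def)
        qed
      qed
    qed
  next
    fix y assume "y \<in> shift_moments j (n - 1) ` cone_slice T m j k"
    then obtain x where x: "x \<in> cone_slice T m j k" "y = shift_moments j (n - 1) x" by blast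
    then show "y \<in> simplex_moments (T - {j}) (k - j * m)"
      using n assms flip_region_shift_moments[OF assms(1,2), of x]
      by (auto simp: simplex_moments_def cone_slice_def int_moments_def card n_def[symmetric]
          image_subset_iff) (auto simp: shift_moments_def)
  next
    fix y assume y: "y \<in> simplex_moments (T - {j}) (k - j * m)"
    define x where "x = rec_nat m (\<lambda>i z. if Suc i < n then y i + j * z else 0)"
    have x0: "x 0 = m" and xSuc: "\<And>i. x (Suc i) = (if Suc i < n then y i + j * x i else 0)"
      by (simp_all add: x_def)
    have shift: "shift_moments j (n - 1) x = y"
      using y n by (auto simp: fun_eq_iff shift_moments_def xSuc simplex_moments_def int_moments_def card)
    have "x i \<in> \<int>" for i
    proof (induction i)
      case (Suc i)
      then show ?case using y assms(4) by (auto simp: xSuc simplex_moments_def int_moments_def)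
    qed (use assms x0 in simp)
    moreover have "x i = 0" if "i \<ge> n" for i
      using that n by (cases i) (auto simp: xSuc)
    moreover have "x 1 = k"
      using n y x0 by (simp add: xSuc simplex_moments_def int_moments_def)
    moreover have "flip_region T (same_sign T x) j"
      using y flip_region_shift_moments[OF assms(1,2), of x] shift
      by (simp add: n_def simplex_moments_def)
    ultimately have "x \<in> cone_slice T m j k"
      using x0 by (auto simp: cone_slice_def int_moments_def n_def)
    then show "y \<in> shift_moments j (n - 1) ` cone_slice T m j k"
      using shift by blast
  qed
qed

section \<open>Positivity, bounds and finiteness\<close>

lemma moment_functional_nonneg:
  assumes "finite T" "\<And>s. s \<in> T \<Longrightarrow> 0 \<le> weight T s x / node_diff T s"
    and "degree q < card T" "\<And>s. s \<in> T \<Longrightarrow> 0 \<le> poly q s"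
  shows "0 \<le> moment_functional x q"
  unfolding moment_functional_lagrange[OF assms(1,3)]
  using assms by (intro sum_nonneg mult_nonneg_nonneg) auto

lemma same_sign_imp_nonneg:
  assumes "finite T" "same_sign T x s"
  shows "0 \<le> weight T s x / node_diff T s"
  using assms node_diff_nonzero[of T s] by (auto simp: zero_le_divide_iff)

lemma not_same_sign_imp_nonpos:
  assumes "\<not> same_sign T x s"
  shows "weight T s x / node_diff T s \<le> 0"
  using assms by (auto simp: divide_le_0_iff)

lemma sum_mass:
  assumes "finite T" "T \<noteq> {}"
  shows "(\<Sum>s\<in>T. weight T s x / node_diff T s) = x 0"
  using moment_functional_lagrange[OF assms(1), of 1 x] assms by (simp add: card_gt_0_iff)

text \<open>At the largest node \<open>node_diff\<close> is positive, so \<open>same_sign\<close>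
  forces strictly positive mass there and nonnegative mass elsewhere.\<close>

lemma simplex_moments_mass_pos:
  assumes "finite T" "T \<noteq> {}" "x \<in> simplex_moments T m"
  shows "m > 0"
proof -
  have "0 < weight T (Max T) x"
    using assms node_diff_max_pos[of T "Max T"] by (auto simp: simplex_moments_def)
  then have "0 < weight T (Max T) x / node_diff T (Max T)"
    using assms node_diff_max_pos[of T "Max T"] by auto
  moreover have "0 \<le> weight T s x / node_diff T s" if "s \<in> T" for s
    using that assms same_sign_imp_nonneg[of T s x] by (auto simp: simplex_moments_def)
  ultimately have "0 < (\<Sum>s\<in>T. weight T s x / node_diff T s)"
    using assms by (intro sum_pos2[of T "Max T"]) auto
  then show ?thesis
    using assms by (simp add: sum_mass simplex_moments_def int_moments_def)
qed

text \<open>Integrate \<open>t - Min T\<close> and \<open>Max T - t\<close>, both nonnegative on the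
  nodes.\<close>

lemma simplex_moments_bounds:
  assumes "finite T" "card T \<ge> 2" "x \<in> simplex_moments T m"
  shows "Min T * m \<le> x 1" and "x 1 \<le> Max T * m"
proof -
  have x: "x 0 = m" "\<And>s. s \<in> T \<Longrightarrow> 0 \<le> weight T s x / node_diff T s"
    using assms same_sign_imp_nonneg[of T _ x] by (auto simp: simplex_moments_def int_moments_def)
  have "0 \<le> moment_functional x [:- Min T, 1:]"
    by (rule moment_functional_nonneg[OF assms(1) x(2)]) (use assms in auto)
  then show "Min T * m \<le> x 1"
    by (simp add: moment_functional_def x(1))
  have "0 \<le> moment_functional x [:Max T, -1:]"
    by (rule moment_functional_nonneg[OF assms(1) x(2)]) (use assms in auto)
  then show "x 1 \<le> Max T * m"
    by (simp add: moment_functional_def x(1))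
qed

lemma finite_Ints_interval: "finite ({a..b::real} \<inter> \<int>)"
proof -
  have "{a..b} \<inter> \<int> \<subseteq> real_of_int ` {\<lfloor>a\<rfloor>..\<lceil>b\<rceil>}"
    by (auto simp: Ints_def floor_le_iff le_ceiling_iff)
  then show ?thesis by (rule finite_subset) auto
qed

text \<open>No node lies below the smallest node \<open>a\<close>, so the simplex is contained in
  the cone at \<open>a\<close>. Finitely many integral first coordinates occur, and each slice of
  the cone is a simplex with one node fewer.\<close>

lemma finite_simplex_moments:
  assumes "finite T" "T \<noteq> {}" "T \<subseteq> \<int>" "m \<in> \<int>"
  shows "finite (simplex_moments T m)"
  using assms
proof (induction "card T" arbitrary: T m)
  case 0
  then show ?case by (metis card_0_eq)
next
  case (Suc d)
  show ?case
  proof (cases "d = 0")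
    case True
    then have "simplex_moments T m \<subseteq> {\<lambda>i. if i = 0 then m else 0}"
      using Suc(2) by (auto simp: simplex_moments_def int_moments_def fun_eq_iff)
    then show ?thesis by (rule finite_subset) auto
  next
    case False
    define a where "a = Min T"
    have a: "a \<in> T" "\<And>s. s \<in> T \<Longrightarrow> a \<le> s" using Suc by (auto simp: a_def)
    have card: "card T \<ge> 2" using False Suc(2) by auto
    have "x \<in> (\<Union>k\<in>{Min T * m..Max T * m} \<inter> \<int>. cone_slice T m a k)"
      if x: "x \<in> simplex_moments T m" for x
    proof
      show "x 1 \<in> {Min T * m..Max T * m} \<inter> \<int>"
        using simplex_moments_bounds[OF Suc.prems(1) card x] x
        by (auto simp: simplex_moments_def int_moments_def)
      have "flip_region T (same_sign T x) a"
        unfolding flip_region_def using x a(2) by (auto simp: simplex_moments_def not_less)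
      then show "x \<in> cone_slice T m a (x 1)"
        using x by (simp add: simplex_moments_def cone_slice_def)
    qed
    then have "simplex_moments T m \<subseteq> (\<Union>k\<in>{Min T * m..Max T * m} \<inter> \<int>. cone_slice T m a k)"
      by blast
    moreover have "finite (cone_slice T m a k)" if "k \<in> \<int>" for k
    proof -
      have "finite (simplex_moments (T - {a}) (k - a * m))"
      proof (rule Suc(1))
        show "d = card (T - {a})" using Suc(2) a Suc.prems by simp
        then show "T - {a} \<noteq> {}" using False by (metis card.empty)
        show "k - a * m \<in> \<int>" using Suc.prems a that by auto
      qed (use Suc.prems in auto)
      then show ?thesis
        using bij_betw_finite[OF bij_betw_cone_slice[OF Suc.prems(1) a(1) card]] a(1) Suc.prems by blast
    qed
    ultimately show ?thesis
      by (elim finite_subset) (intro finite_UN_I finite_Ints_interval, auto)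
  qed
qed

section \<open>Counting slice by slice\<close>

definition moments_slice :: "real set \<Rightarrow> real \<Rightarrow> real \<Rightarrow> (nat \<Rightarrow> real) set" where
  "moments_slice T m k = {x \<in> simplex_moments T m. x 1 = k}"

text \<open>This is \<open>sum_flip_region\<close> for \<open>same_sign T x\<close>. The everywhere
  false pattern cannot occur: all masses would be nonpositive although they add up to
  \<open>m > 0\<close>.\<close>

lemma moments_slice_indicator:
  assumes "finite T" "T \<noteq> {}" "m > 0" "x \<in> int_moments (card T) m" "x 1 = k"
  shows "of_bool (x \<in> moments_slice T m k)
    = - ((- 1) ^ card T) * (\<Sum>j\<in>T. sgn (node_diff T j) * of_bool (x \<in> cone_slice T m j k))"
proof -
  have none: "\<not> (\<forall>s\<in>T. \<not> same_sign T x s)"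
  proof
    assume *: "\<forall>s\<in>T. \<not> same_sign T x s"
    have "(\<Sum>s\<in>T. weight T s x / node_diff T s) \<le> 0"
    proof (rule sum_nonpos)
      fix s assume "s \<in> T"
      with * have "\<not> same_sign T x s" by (rule bspec)
      then show "weight T s x / node_diff T s \<le> 0" by (rule not_same_sign_imp_nonpos)
    qed
    moreover have "x 0 = m" using assms(4) by (simp add: int_moments_def)
    ultimately show False
      using assms(3) unfolding sum_mass[OF assms(1,2)] by linarith
  qed
  have "(\<Sum>j\<in>T. sgn (node_diff T j) * of_bool (x \<in> cone_slice T m j k))
      = (\<Sum>j\<in>T. sgn (node_diff T j) * of_bool (flip_region T (same_sign T x) j))"
    using assms(4,5) by (simp add: cone_slice_def)
  also have "\<dots> = - ((- 1) ^ card T) * of_bool (\<forall>s\<in>T. same_sign T x s)"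
  proof -
    have "of_bool (\<forall>s\<in>T. \<not> same_sign T x s) = (0 :: real)" using none by simp
    then show ?thesis unfolding sum_flip_region[OF assms(1)] by simp
  qed
  also have "\<dots> = - ((- 1) ^ card T) * of_bool (x \<in> moments_slice T m k)"
    using assms(4,5) by (simp add: moments_slice_def simplex_moments_def)
  finally have "(\<Sum>j\<in>T. sgn (node_diff T j) * of_bool (x \<in> cone_slice T m j k))
    = - ((- 1) ^ card T) * of_bool (x \<in> moments_slice T m k)" .
  then show ?thesis
    by (cases "even (card T)") (simp_all del: sum_mult_of_bool_eq)
qed

lemma finite_cone_slice:
  assumes "finite T" "card T \<ge> 2" "T \<subseteq> \<int>" "m \<in> \<int>" "k \<in> \<int>" "j \<in> T"
  shows "finite (cone_slice T m j k)"
proof -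
  have "card (T - {j}) \<noteq> 0" using assms by simp
  then have "T - {j} \<noteq> {}" by (metis card.empty)
  then have "finite (simplex_moments (T - {j}) (k - j * m))"
    using assms by (intro finite_simplex_moments) auto
  then show ?thesis
    using bij_betw_finite[OF bij_betw_cone_slice[OF assms(1,6,2)]] assms by blast
qed

lemma card_eq_sum_of_bool:
  assumes "finite X" "A \<subseteq> X"
  shows "real (card A) = (\<Sum>x\<in>X. of_bool (x \<in> A))"
proof -
  have "(\<Sum>x\<in>X. of_bool (x \<in> A)) = (\<Sum>x\<in>A. 1 :: real)"
    using assms by (intro sum.mono_neutral_cong_right) auto
  then show ?thesis by simp
qed

lemma card_moments_slice:
  assumes "finite T" "card T \<ge> 2" "T \<subseteq> \<int>" "m \<in> \<int>" "m > 0" "k \<in> \<int>"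
  shows "real (card (moments_slice T m k))
    = - ((- 1) ^ card T) * (\<Sum>j\<in>T. sgn (node_diff T j) * real (card (simplex_moments (T - {j}) (k - j * m))))"
proof -
  have ne: "T \<noteq> {}" using assms(2) by auto
  \<comment> \<open>A finite set over which all indicators are summed. It contains the slice because
    the signed sum is nonzero at each point of the slice.\<close>
  define X where "X = (\<Union>j\<in>T. cone_slice T m j k)"
  have X: "finite X"
    unfolding X_def using assms finite_cone_slice by blast
  have X_int: "x \<in> int_moments (card T) m \<and> x 1 = k" if "x \<in> X" for x
    using that by (auto simp: X_def cone_slice_def)
  have sub: "moments_slice T m k \<subseteq> X"
  proof
    fix x assume x: "x \<in> moments_slice T m k"
    then have "x \<in> int_moments (card T) m" "x 1 = k"
      by (auto simp: moments_slice_def simplex_moments_def)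
    then have "(\<Sum>j\<in>T. sgn (node_diff T j) * of_bool (x \<in> cone_slice T m j k)) \<noteq> 0"
      using moments_slice_indicator[OF assms(1) ne assms(5), of x k] x by auto
    then obtain j where "j \<in> T" "sgn (node_diff T j) * of_bool (x \<in> cone_slice T m j k) \<noteq> 0"
      by (meson sum.neutral)
    then show "x \<in> X" unfolding X_def by auto
  qed
  have "real (card (moments_slice T m k)) = (\<Sum>x\<in>X. of_bool (x \<in> moments_slice T m k))"
    by (rule card_eq_sum_of_bool[OF X sub])
  also have "\<dots> = (\<Sum>x\<in>X. - ((- 1) ^ card T) * (\<Sum>j\<in>T. sgn (node_diff T j) * of_bool (x \<in> cone_slice T m j k)))"
    using moments_slice_indicator[OF assms(1) ne assms(5)] X_int by (intro sum.cong) blast+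
  also have "\<dots> = - ((- 1) ^ card T) * (\<Sum>j\<in>T. sgn (node_diff T j) * (\<Sum>x\<in>X. of_bool (x \<in> cone_slice T m j k)))"
    unfolding sum_distrib_left[symmetric] by (subst sum.swap) (simp only: sum_distrib_left)
  also have "\<dots> = - ((- 1) ^ card T) * (\<Sum>j\<in>T. sgn (node_diff T j) * real (card (cone_slice T m j k)))"
    by (intro arg_cong2[where f = "(*)"] sum.cong refl card_eq_sum_of_bool[OF X, symmetric])
      (auto simp: X_def)
  also have "\<dots> = - ((- 1) ^ card T) * (\<Sum>j\<in>T. sgn (node_diff T j) * real (card (simplex_moments (T - {j}) (k - j * m))))"
    using bij_betw_same_card[OF bij_betw_cone_slice[OF assms(1) _ assms(2) _ assms(4)]] assms(3)
    by (intro arg_cong2[where f = "(*)"] sum.cong refl) auto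
  finally show ?thesis .
qed

text \<open>Substitute \<open>k = a + i\<close>; terms with \<open>k \<le> a\<close> vanish. The
  guard matters even at \<open>k = a\<close>, since \<open>0 ^ e\<close> is 1 for
  \<open>e = 0\<close>.\<close>

lemma sum_powers_Ints:
  fixes a b c :: real
  assumes "a \<in> \<int>" "b \<in> \<int>" "c \<le> a" "a \<le> b"
  shows "(\<Sum>k\<in>{c..b} \<inter> \<int>. if k - a > 0 then (k - a) ^ e else 0) = (\<Sum>i=1..nat \<lfloor>b - a\<rfloor>. real i ^ e)"
proof -
  obtain u v where uv: "a = real_of_int u" "b = real_of_int v" "u \<le> v"
    using assms by (auto elim!: Ints_cases)
  have "(\<Sum>k\<in>{c..b} \<inter> \<int>. if k - a > 0 then (k - a) ^ e else 0)
      = (\<Sum>k\<in>{k \<in> {c..b} \<inter> \<int>. k - a > 0}. (k - a) ^ e)"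
    by (rule sum.inter_filter[symmetric]) (rule finite_Ints_interval)
  also have "\<dots> = (\<Sum>i=1..nat \<lfloor>b - a\<rfloor>. real i ^ e)"
  proof (rule sum.reindex_bij_witness[of _ "\<lambda>i. a + real i" "\<lambda>k. nat \<lfloor>k - a\<rfloor>"])
    fix k assume k: "k \<in> {k \<in> {c..b} \<inter> \<int>. k - a > 0}"
    then obtain w where w: "k = real_of_int w" by (auto elim!: Ints_cases)
    have "real (nat \<lfloor>k - a\<rfloor>) = k - a"
      using k by (simp add: w uv)
    then show "a + real (nat \<lfloor>k - a\<rfloor>) = k" "real (nat \<lfloor>k - a\<rfloor>) ^ e = (k - a) ^ e"
      by simp_all
    show "nat \<lfloor>k - a\<rfloor> \<in> {1..nat \<lfloor>b - a\<rfloor>}"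
      using k by (auto simp: w uv)
  next
    fix i assume "i \<in> {1..nat \<lfloor>b - a\<rfloor>}"
    then show "nat \<lfloor>a + real i - a\<rfloor> = i" "a + real i \<in> {k \<in> {c..b} \<inter> \<int>. k - a > 0}"
      using assms by (auto simp: uv)
  qed
  finally show ?thesis .
qed

text \<open>Induction on the dimension for all \<open>T\<close> and \<open>m\<close> at once, since
  the slices are counted by smaller simplices of mass \<open>k - j * m\<close>.\<close>

lemma card_simplex_moments:
  assumes "finite T" "T \<subseteq> \<int>" "card T = Suc d" "m \<in> \<int>"
  shows "real (card (simplex_moments T m)) = (if m > 0 then vandermonde T * m ^ d / fact d else 0)"
  using assms
proof (induction d arbitrary: T m)
  case 0
  then obtain t where t: "T = {t}" by (auto simp: card_1_singleton_iff)
  show ?case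
  proof (cases "m > 0")
    case True
    define x where "x = (\<lambda>i::nat. if i = 0 then m else 0)"
    have "simplex_moments T m = {x}"
      using True \<open>m \<in> \<int>\<close>
      by (auto simp: t simplex_moments_def int_moments_def x_def fun_eq_iff weight_def node_poly_def
          node_diff_def)
    then show ?thesis using True by (simp add: t)
  next
    case False
    then have "simplex_moments T m = {}"
      using simplex_moments_mass_pos[of T _ m] 0 t by auto
    then show ?thesis using False by simp
  qed
next
  case (Suc d)
  have ne: "T \<noteq> {}" and card2: "card T \<ge> 2" using Suc.prems by auto
  show ?case
  proof (cases "m > 0")
    case False
    then have "simplex_moments T m = {}"
      using simplex_moments_mass_pos[of T _ m] Suc.prems ne by auto
    then show ?thesis using False by simp
  next
    case True
    define K where "K = {Min T * m..Max T * m} \<inter> \<int>"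
    define b where "b = Max T * m"
    have "Max T \<in> \<int>" using Max_in[OF Suc.prems(1) ne] Suc.prems(2) by blast
    then have b: "b \<in> \<int>" using Suc.prems(4) unfolding b_def by (rule Ints_mult)
    obtain p :: "real poly" where p: "degree p \<le> Suc d" "coeff p (Suc d) = 1 / real (Suc d)"
      "\<And>n. poly p (real n) = (\<Sum>i=1..n. real i ^ d)"
      using power_sum_poly_exists[of d] by blast
    have deg_p: "degree p = Suc d"
      using p(1,2) by (intro antisym le_degree) auto
    \<comment> \<open>For a node \<open>j\<close>, \<open>poly q j\<close> is the sum of the
      \<open>d\<close>-th powers of \<open>1, ..., b - j * m\<close>, the positive masses of the
      slices of the cone at \<open>j\<close> up to \<open>x 1 = b\<close>.\<close>
    define q where "q = pcompose p [:b, - m:]"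
    have deg_q: "degree q = Suc d"
      using True by (simp add: q_def deg_p degree_pcompose)
    have "lead_coeff q = lead_coeff p * (- m) ^ degree p"
      unfolding q_def using True by (subst lead_coeff_comp) auto
    then have coeff_q: "coeff q (Suc d) = (- m) ^ Suc d / real (Suc d)"
      by (simp add: deg_p deg_q p(2))
    have slices: "simplex_moments T m = (\<Union>k\<in>K. moments_slice T m k)"
      using simplex_moments_bounds[OF Suc.prems(1) card2]
      by (auto simp: K_def moments_slice_def simplex_moments_def int_moments_def image_subset_iff)
    have fin: "finite (simplex_moments T m)"
      using finite_simplex_moments Suc.prems ne by blast
    have "card (simplex_moments T m) = (\<Sum>k\<in>K. card (moments_slice T m k))"
      unfolding slices
    proof (rule card_UN_disjoint)
      show "finite K" by (simp add: K_def finite_Ints_interval)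
      show "\<forall>k\<in>K. finite (moments_slice T m k)"
        using fin finite_subset[of "moments_slice T m _" "simplex_moments T m"]
        by (auto simp: moments_slice_def)
    qed (auto simp: moments_slice_def)
    then have "real (card (simplex_moments T m))
        = (\<Sum>k\<in>K. - ((- 1) ^ card T) * (\<Sum>j\<in>T. sgn (node_diff T j)
            * real (card (simplex_moments (T - {j}) (k - j * m)))))"
      using card_moments_slice[OF Suc.prems(1) card2 Suc.prems(2,4) True] by (simp add: K_def)
    also have "\<dots> = - ((- 1) ^ card T) * (\<Sum>j\<in>T. sgn (node_diff T j)
            * (\<Sum>k\<in>K. real (card (simplex_moments (T - {j}) (k - j * m)))))"
      unfolding sum_distrib_left[symmetric] by (subst sum.swap) (simp only: sum_distrib_left)
    \<comment> \<open>By \<open>vandermonde_remove\<close>,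
      \<open>sgn (node_diff T j) * vandermonde (T - {j})\<close> equals
      \<open>vandermonde T / node_diff T j\<close>, which turns the signed sum into a divided
      difference of \<open>q\<close>.\<close>
    also have "\<dots> = - ((- 1) ^ card T) * (\<Sum>j\<in>T. vandermonde T / fact d * (poly q j / node_diff T j))"
    proof (rule arg_cong[where f = "(*) (- ((- 1) ^ card T))"], rule sum.cong[OF refl])
      fix j assume j: "j \<in> T"
      have jb: "j * m \<le> b" and aj: "Min T * m \<le> j * m" and jm: "j * m \<in> \<int>"
        using j Suc.prems True by (auto simp: b_def)
      have "(\<Sum>k\<in>K. real (card (simplex_moments (T - {j}) (k - j * m))))
          = (\<Sum>k\<in>K. vandermonde (T - {j}) / fact d * (if k - j * m > 0 then (k - j * m) ^ d else 0))"
      proof (rule sum.cong[OF refl])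
        fix k assume "k \<in> K"
        then have "k - j * m \<in> \<int>" using jm by (auto simp: K_def)
        then show "real (card (simplex_moments (T - {j}) (k - j * m)))
          = vandermonde (T - {j}) / fact d * (if k - j * m > 0 then (k - j * m) ^ d else 0)"
          using Suc.IH[of "T - {j}" "k - j * m"] Suc.prems j by (simp add: subset_eq)
      qed
      also have "\<dots> = vandermonde (T - {j}) / fact d * poly p (real (nat \<lfloor>b - j * m\<rfloor>))"
        unfolding sum_distrib_left[symmetric] K_def b_def[symmetric] p(3)
          sum_powers_Ints[OF jm b aj jb] ..
      also have "real (nat \<lfloor>b - j * m\<rfloor>) = b - j * m"
        using jb b jm by (auto elim!: Ints_cases)
      also have "poly p (b - j * m) = poly q j"
        by (simp add: q_def poly_pcompose)
      finally have *: "(\<Sum>k\<in>K. real (card (simplex_moments (T - {j}) (k - j * m))))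
          = vandermonde (T - {j}) / fact d * poly q j" .
      show "sgn (node_diff T j) * (\<Sum>k\<in>K. real (card (simplex_moments (T - {j}) (k - j * m))))
          = vandermonde T / fact d * (poly q j / node_diff T j)"
        unfolding * vandermonde_remove[OF Suc.prems(1) j]
        using node_diff_nonzero[OF Suc.prems(1), of j] by (simp add: sgn_if)
    qed
    \<comment> \<open>The degree of \<open>q\<close> is exactly \<open>card T - 1\<close>, so only
      its leading coefficient survives.\<close>
    also have "\<dots> = - ((- 1) ^ card T) * (vandermonde T / fact d * coeff q (Suc d))"
      using sum_divided_difference[OF Suc.prems(1), of q] Suc.prems(3) deg_q
      by (simp add: sum_distrib_left[symmetric] del: times_divide_eq_left times_divide_eq_right)
    \<comment> \<open>As \<open>card T = Suc (Suc d)\<close>, the sign in front cancels that of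
      \<open>(- m) ^ Suc d\<close>.\<close>
    also have "\<dots> = vandermonde T * m ^ Suc d / fact (Suc d)"
      unfolding coeff_q Suc.prems(3) power_minus[of m] by (simp add: field_simps)
    finally show ?thesis using True by simp
  qed
qed

section \<open>Lattice points above the lower boundary\<close>

text \<open>The 1-based position of an index, which is the exponent at that coordinate of the moment
  curve.\<close>

definition coord :: "'d::{finite,linorder} \<Rightarrow> nat" where
  "coord i = card {..i}"

lemma coord_less: "i < j \<Longrightarrow> coord i < coord j"
  unfolding coord_def by (rule psubset_card_mono) auto

lemma coord_less_iff [simp]: "coord i < coord j \<longleftrightarrow> i < j"
  using coord_less by (metis linorder_less_linear order_less_asym)

lemma coord_eq_iff [simp]: "coord i = coord j \<longleftrightarrow> i = j"
  by (metis coord_less_iff linorder_less_linear order_less_irrefl)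

lemma bij_betw_coord: "bij_betw (coord :: 'd \<Rightarrow> nat) UNIV {1..CARD('d::{finite,linorder})}"
proof -
  have "coord i \<in> {1..CARD('d)}" for i :: 'd
    using card_mono[of UNIV "{..i}"] card_gt_0_iff[of "{..i}"] by (auto simp: coord_def Suc_le_eq)
  moreover have "card (range (coord :: 'd \<Rightarrow> nat)) = CARD('d)"
    by (rule card_image) (simp add: inj_on_def)
  ultimately have "range (coord :: 'd \<Rightarrow> nat) = {1..CARD('d)}"
    by (intro card_subset_eq) auto
  then show ?thesis by (simp add: bij_betw_def inj_on_def)
qed

lemma coord_range: "1 \<le> coord (i :: 'd::{finite,linorder})" "coord i \<le> CARD('d)"
  using bij_betwE[OF bij_betw_coord, rule_format, of i] by auto

lemma coord_last: "coord (last_coord :: 'd::{finite,linorder}) = CARD('d)"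
proof -
  have "{..last_coord :: 'd} = UNIV"
    by (auto simp: last_coord_def)
  then show ?thesis by (simp add: coord_def)
qed

text \<open>A point read as moments \<open>1, ..., d\<close>, with the mass \<open>m\<close> put in
  front as moment 0.\<close>

definition moment_seq :: "real \<Rightarrow> real ^ 'd::{finite,linorder} \<Rightarrow> nat \<Rightarrow> real" where
  "moment_seq m x n = (if n = 0 then m else if n \<le> CARD('d) then x $ inv coord n else 0)"

lemma inv_coord [simp]: "inv coord (coord i) = i"
  by (rule inv_f_f) (simp add: inj_on_def)

lemma moment_seq_0 [simp]: "moment_seq m x 0 = m"
  by (simp add: moment_seq_def)

lemma moment_seq_coord [simp]: "moment_seq m x (coord i) = x $ i"
  using coord_range[of i] by (simp add: moment_seq_def)

lemma coord_cases:
  assumes "n \<le> CARD('d::{finite,linorder})"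
  obtains "n = 0" | i :: "'d::{finite,linorder}" where "n = coord i"
proof (cases "n = 0")
  case False
  then have "n \<in> coord ` (UNIV :: 'd set)"
    using bij_betw_imp_surj_on[OF bij_betw_coord[where 'd='d]] assms by auto
  then show ?thesis using that(2) by blast
qed (use that in blast)

text \<open>Mass and point are combined together, which covers convex combinations, dilations and
  moves along a direction of mass 0.\<close>

lemma moment_seq_combination:
  fixes x y :: "real ^ 'd::{finite,linorder}"
  shows "moment_seq (a * m + b * l) (a *\<^sub>R x + b *\<^sub>R y) n = a * moment_seq m x n + b * moment_seq l y n"
  by (simp add: moment_seq_def)

lemma weight_moment_seq_combination:
  "weight T s (moment_seq (a * m + b * l) (a *\<^sub>R x + b *\<^sub>R y))
    = a * weight T s (moment_seq m x) + b * weight T s (moment_seq l y)"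
  unfolding weight_def moment_functional_linear_args[symmetric]
  by (simp add: moment_seq_combination[abs_def])

text \<open>A point of the curve has the moments of the unit mass at \<open>t\<close>, for which
  integration is evaluation.\<close>

lemma weight_moment_curve:
  assumes "finite T" "card T = Suc CARD('d::{finite,linorder})" "s \<in> T"
  shows "weight T s (moment_seq 1 (moment_curve t :: real ^ 'd::{finite,linorder})) = poly (node_poly T s) t"
proof -
  have "moment_functional (moment_seq 1 (moment_curve t :: (real, 'd) vec)) (node_poly T s)
      = moment_functional (\<lambda>n. t ^ n) (node_poly T s)"
  proof (rule moment_functional_cong)
    show "degree (node_poly T s) < card T" using assms by (intro degree_node_poly_less)
    fix n assume "n < card T"
    then have "n \<le> CARD('d)" using assms by simp
    then show "moment_seq 1 (moment_curve t :: (real, 'd) vec) n = t ^ n"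
      by (cases rule: coord_cases[where 'd='d]) (simp_all add: moment_curve_def coord_def[symmetric])
  qed
  then show ?thesis by (simp add: weight_def moment_functional_power)
qed

text \<open>The quotients are barycentric coordinates. They are affine and nonnegative at the
  vertices, hence on the hull; conversely, integrating monomials writes \<open>x\<close> as the
  combination of the vertices with these coefficients.\<close>

lemma mem_hull_iff_mass:
  fixes x :: "real ^ 'd::{finite,linorder}"
  assumes T: "finite T" "card T = Suc CARD('d)"
  shows "x \<in> convex hull (moment_curve ` T)
    \<longleftrightarrow> (\<forall>s\<in>T. 0 \<le> weight T s (moment_seq 1 x) / node_diff T s)"
proof
  let ?S = "{x :: (real, 'd) vec. \<forall>s\<in>T. 0 \<le> weight T s (moment_seq 1 x) / node_diff T s}"
  assume "x \<in> convex hull (moment_curve ` T)"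
  moreover have "convex hull (moment_curve ` T) \<subseteq> ?S"
  proof (rule hull_minimal)
    have "poly (node_poly T s) t / node_diff T s \<ge> 0" if "s \<in> T" "t \<in> T" for s t
      using that T node_diff_nonzero[of T s]
      by (cases "s = t") (simp_all add: poly_node_poly_self poly_node_poly_other)
    then show "moment_curve ` T \<subseteq> ?S"
      using T by (auto simp: weight_moment_curve)
    show "convex ?S"
    proof (rule convexI, safe)
      fix x y :: "(real, 'd) vec" and u v :: real and s
      assume *: "\<forall>s\<in>T. 0 \<le> weight T s (moment_seq 1 x) / node_diff T s"
        "\<forall>s\<in>T. 0 \<le> weight T s (moment_seq 1 y) / node_diff T s" "0 \<le> u" "0 \<le> v" "u + v = 1" "s \<in> T"
      then show "0 \<le> weight T s (moment_seq 1 (u *\<^sub>R x + v *\<^sub>R y)) / node_diff T s"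
        using weight_moment_seq_combination[of T s u 1 v 1 x y]
        by (simp add: add_divide_distrib mult_nonneg_nonneg flip: times_divide_eq_right)
    qed
  qed
  ultimately show "\<forall>s\<in>T. 0 \<le> weight T s (moment_seq 1 x) / node_diff T s" by blast
next
  let ?u = "\<lambda>s. weight T s (moment_seq 1 x) / node_diff T s"
  assume nonneg: "\<forall>s\<in>T. 0 \<le> ?u s"
  have "T \<noteq> {}" using T by auto
  then have "sum ?u T = 1" using sum_mass[OF T(1), of "moment_seq 1 x"] by simp
  then have "(\<Sum>s\<in>T. ?u s *\<^sub>R (moment_curve s :: (real, 'd) vec)) \<in> convex hull (moment_curve ` T)"
    using T nonneg by (intro convex_sum convex_convex_hull) (auto intro: hull_inc)
  also have "(\<Sum>s\<in>T. ?u s *\<^sub>R (moment_curve s :: (real, 'd) vec)) = x"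
  proof (rule vec_eq_iff[THEN iffD2], rule allI)
    fix i :: 'd
    have "x $ i = moment_functional (moment_seq 1 x) (monom 1 (coord i))"
      by (simp add: moment_functional_monom)
    also have "\<dots> = (\<Sum>s\<in>T. poly (monom 1 (coord i)) s * ?u s)"
      using T coord_range[of i] by (intro moment_functional_lagrange) (auto simp: degree_monom_eq)
    also have "\<dots> = (\<Sum>s\<in>T. ?u s *\<^sub>R (moment_curve s :: (real, 'd) vec)) $ i"
      by (simp add: poly_monom moment_curve_def coord_def mult.commute)
    finally show "(\<Sum>s\<in>T. ?u s *\<^sub>R (moment_curve s :: (real, 'd) vec)) $ i = x $ i" ..
  qed
  finally show "x \<in> convex hull (moment_curve ` T)" .
qed

lemma mem_dilate_hull_iff_mass:
  fixes x :: "real ^ 'd::{finite,linorder}"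
  assumes T: "finite T" "card T = Suc CARD('d)" and "m > 0"
  shows "x \<in> dilate m (convex hull (moment_curve ` T))
    \<longleftrightarrow> (\<forall>s\<in>T. 0 \<le> weight T s (moment_seq (real m) x) / node_diff T s)"
proof -
  define y where "y = x /\<^sub>R real m"
  have x: "x = real m *\<^sub>R y" using \<open>m > 0\<close> by (simp add: y_def)
  have "x \<in> dilate m (convex hull (moment_curve ` T)) \<longleftrightarrow> y \<in> convex hull (moment_curve ` T)"
    using \<open>m > 0\<close> by (auto simp: dilate_def x)
  also have "\<dots> \<longleftrightarrow> (\<forall>s\<in>T. 0 \<le> weight T s (moment_seq (real m) x) / node_diff T s)"
    using weight_moment_seq_combination[of T _ "real m" 1 0 1 y y] \<open>m > 0\<close>
    by (simp add: mem_hull_iff_mass[OF T] x zero_le_divide_iff zero_le_mult_iff mult_le_0_iff)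
  finally show ?thesis .
qed

section \<open>The lower boundary in terms of weights\<close>

lemma forget_last_eq_iff: "forget_last x = forget_last y \<longleftrightarrow> (\<forall>i. i \<noteq> last_coord \<longrightarrow> x $ i = y $ i)"
  by (auto simp: forget_last_def fun_eq_iff restrict_def)

lemma lowest_point_eq:
  assumes "x \<in> P" "\<And>z. z \<in> P \<Longrightarrow> forget_last z = forget_last x \<Longrightarrow> x $ last_coord \<le> z $ last_coord"
  shows "lowest_point (forget_last x) P = x"
proof -
  let ?z = "lowest_point (forget_last x) P"
  have z: "?z \<in> P \<and> forget_last ?z = forget_last x \<and> ?z $ last_coord \<le> x $ last_coord"
    unfolding lowest_point_def
    by (rule arg_minI[where x = x]) (use assms in \<open>auto simp: not_less\<close>)
  with assms have "?z $ last_coord = x $ last_coord" by (simp add: order_antisym)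
  moreover have "?z $ i = x $ i" if "i \<noteq> last_coord" for i
    using z that unfolding forget_last_eq_iff by blast
  ultimately show ?thesis unfolding vec_eq_iff by metis
qed

text \<open>Compactness makes the minimum over each nonempty fibre exist, so
  \<open>lowest_point\<close> is a true minimiser there.\<close>

lemma mem_negative_boundary_iff:
  assumes "compact P"
  shows "x \<in> negative_boundary P
    \<longleftrightarrow> x \<in> P \<and> (\<forall>z\<in>P. forget_last z = forget_last x \<longrightarrow> x $ last_coord \<le> z $ last_coord)"
    (is "_ \<longleftrightarrow> ?R x")
proof
  assume "?R x"
  then have "lowest_point (forget_last x) P = x" by (intro lowest_point_eq) auto
  then show "x \<in> negative_boundary P" using \<open>?R x\<close> unfolding negative_boundary_def by force
next
  assume "x \<in> negative_boundary P"
  then obtain w where w: "w \<in> P" "x = lowest_point (forget_last w) P"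
    by (auto simp: negative_boundary_def)
  define F where "F = P \<inter> (\<Inter>i\<in>- {last_coord}. {z. z $ i = w $ i})"
  have F: "z \<in> F \<longleftrightarrow> z \<in> P \<and> forget_last z = forget_last w" for z
    by (auto simp: F_def forget_last_eq_iff)
  have "closed (\<Inter>i\<in>- {last_coord}. {z. z $ i = w $ i})"
    by (intro closed_INT ballI closed_Collect_eq continuous_intros)
  then have "compact F" unfolding F_def using assms by (rule compact_Int_closed[rotated])
  moreover have "F \<noteq> {}" using w(1) F by blast
  moreover have "continuous_on F (\<lambda>z. z $ last_coord)" by (intro continuous_intros)
  ultimately have "\<exists>z\<in>F. \<forall>y\<in>F. z $ last_coord \<le> y $ last_coord"
    by (rule continuous_attains_inf)
  then obtain z where z: "z \<in> F" "\<And>y. y \<in> F \<Longrightarrow> z $ last_coord \<le> y $ last_coord"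
    by auto
  then have "lowest_point (forget_last z) P = z" by (intro lowest_point_eq) (auto simp: F)
  moreover have zF: "z \<in> P" "forget_last z = forget_last w" using z(1) F by auto
  ultimately have "x = z" using w(2) by simp
  with zF show "?R x" using z(2) F by simp
qed

text \<open>Node polynomials are monic of degree \<open>d\<close>, so the last coordinate enters
  every weight with coefficient 1.\<close>

lemma weight_lower_last:
  fixes x :: "real ^ 'd::{finite,linorder}"
  assumes "finite T" "card T = Suc CARD('d)" "s \<in> T"
  shows "weight T s (moment_seq m (x - e *\<^sub>R axis last_coord 1)) = weight T s (moment_seq m x) - e"
proof -
  have "weight T s (moment_seq m (x - e *\<^sub>R axis last_coord 1))
      = weight T s (moment_seq m x) - e * weight T s (moment_seq 0 (axis last_coord 1 :: (real, 'd) vec))"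
    using weight_moment_seq_combination[of T s 1 m "- e" 0 x "axis last_coord 1"] by simp
  also have "weight T s (moment_seq 0 (axis last_coord 1 :: (real, 'd) vec))
      = moment_functional (\<lambda>n. if n = CARD('d) then 1 else 0) (node_poly T s)"
    unfolding weight_def
  proof (rule moment_functional_cong)
    show "degree (node_poly T s) < card T" using assms by (intro degree_node_poly_less)
    fix n assume "n < card T"
    then have "n \<le> CARD('d)" using assms by simp
    then show "moment_seq 0 (axis last_coord 1 :: (real, 'd) vec) n = (if n = CARD('d) then 1 else 0)"
    proof (cases rule: coord_cases[where 'd='d])
      case (2 i)
      then show ?thesis using coord_last[where 'd='d] coord_eq_iff[of i last_coord]
        by (simp add: axis_def del: coord_eq_iff)
    qed simp
  qed
  also have "\<dots> = 1"
    using coeff_node_poly[OF assms(3)] degree_node_poly[OF assms(3)] assms(2)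
    by (simp add: moment_functional_def if_distrib sum.delta cong: if_cong)
  finally show ?thesis by simp
qed

text \<open>A point of the polytope survives iff it can be lowered by some \<open>e > 0\<close>
  inside it. Lowering subtracts \<open>e\<close> from all weights, which needs strict positivity
  where \<open>node_diff T s > 0\<close> and is harmless where
  \<open>node_diff T s < 0\<close>.\<close>

lemma mem_nonneg_part_iff:
  fixes x :: "real ^ 'd::{finite,linorder}"
  assumes T: "finite T" "card T = Suc CARD('d)" and m: "m > 0"
  shows "x \<in> nonneg_part (dilate m (convex hull (moment_curve ` T)))
    \<longleftrightarrow> (\<forall>s\<in>T. same_sign T (moment_seq (real m) x) s)"
proof -
  define P where "P = dilate m (convex hull (moment_curve ` T) :: ((real, 'd) vec) set)"
  let ?w = "\<lambda>s. weight T s (moment_seq (real m) x)"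
  have ne: "T \<noteq> {}" using T by auto
  have "compact P"
    unfolding P_def dilate_def using T by (intro compact_scaling finite_imp_compact_convex_hull) auto
  then have "x \<in> nonneg_part P
      \<longleftrightarrow> x \<in> P \<and> (\<exists>z\<in>P. forget_last z = forget_last x \<and> z $ last_coord < x $ last_coord)"
    by (auto simp: nonneg_part_def mem_negative_boundary_iff not_le)
  also have "\<dots> \<longleftrightarrow> x \<in> P \<and> (\<exists>e>0. x - e *\<^sub>R axis last_coord 1 \<in> P)"
  proof (intro conj_cong refl iffI)
    assume "\<exists>z\<in>P. forget_last z = forget_last x \<and> z $ last_coord < x $ last_coord"
    then obtain z where z: "z \<in> P" "forget_last z = forget_last x" "z $ last_coord < x $ last_coord"
      by blast
    have "x - (x $ last_coord - z $ last_coord) *\<^sub>R axis last_coord 1 = z"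
      using z(2) by (auto simp: vec_eq_iff axis_def forget_last_eq_iff)
    then show "\<exists>e>0. x - e *\<^sub>R axis last_coord 1 \<in> P"
      using z by (intro exI[of _ "x $ last_coord - z $ last_coord"]) simp
  next
    assume "\<exists>e>0. x - e *\<^sub>R axis last_coord 1 \<in> P"
    then obtain e where "e > 0" "x - e *\<^sub>R axis last_coord 1 \<in> P" by blast
    then show "\<exists>z\<in>P. forget_last z = forget_last x \<and> z $ last_coord < x $ last_coord"
      by (intro bexI[of _ "x - e *\<^sub>R axis last_coord 1"]) (auto simp: forget_last_eq_iff axis_def)
  qed
  also have "\<dots> \<longleftrightarrow> (\<forall>s\<in>T. 0 \<le> ?w s / node_diff T s)
      \<and> (\<exists>e>0. \<forall>s\<in>T. 0 \<le> (?w s - e) / node_diff T s)"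
    unfolding P_def mem_dilate_hull_iff_mass[OF T m] by (simp add: weight_lower_last[OF T] cong: ball_cong)
  also have "\<dots> \<longleftrightarrow> (\<forall>s\<in>T. same_sign T (moment_seq (real m) x) s)"
  proof safe
    fix e s assume *: "\<forall>s\<in>T. 0 \<le> (?w s - e) / node_diff T s" "s \<in> T" "0 < node_diff T s" "e > 0"
    then show "0 < ?w s" by (force simp: zero_le_divide_iff)
  next
    fix s assume *: "\<forall>s\<in>T. 0 \<le> ?w s / node_diff T s" "s \<in> T" "0 < ?w s"
    then show "0 < node_diff T s"
      using node_diff_nonzero[OF T(1), of s] by (force simp: zero_le_divide_iff)
  next
    fix s assume "\<forall>s\<in>T. same_sign T (moment_seq (real m) x) s" "s \<in> T"
    then show "0 \<le> ?w s / node_diff T s"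
      using same_sign_imp_nonneg[OF T(1)] by blast
  next
    assume *: "\<forall>s\<in>T. same_sign T (moment_seq (real m) x) s"
    \<comment> \<open>The minimum of these weights serves as \<open>e\<close>; the node
      \<open>Max T\<close> shows that there is at least one.\<close>
    define A where "A = ?w ` {s \<in> T. 0 < node_diff T s}"
    have "Max T \<in> {s \<in> T. 0 < node_diff T s}"
      using node_diff_max_pos[of T "Max T"] T ne by auto
    then have A: "finite A" "A \<noteq> {}" using T by (auto simp: A_def)
    have "0 < ?w s" if "s \<in> T" "0 < node_diff T s" for s using bspec[OF * that(1)] that(2) by blast
    then have "Min A > 0" using A unfolding A_def by auto
    moreover have "0 \<le> (?w s - Min A) / node_diff T s" if s: "s \<in> T" for s
    proof (cases "0 < node_diff T s")
      case True
      then have "Min A \<le> ?w s" using A s by (auto simp: A_def)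
      then show ?thesis using True by simp
    next
      case False
      then have "\<not> 0 < ?w s" using bspec[OF * s] by blast
      then show ?thesis using False \<open>Min A > 0\<close> by (simp add: zero_le_divide_iff not_less)
    qed
    ultimately show "\<exists>e>0. \<forall>s\<in>T. 0 \<le> (?w s - e) / node_diff T s" by blast
  qed
  finally show ?thesis unfolding P_def .
qed

lemma card_lattice_points_nonneg_part:
  assumes T: "finite T" "card T = Suc CARD('d::{finite,linorder})" and m: "m > 0"
  shows "card (lattice_points (nonneg_part (dilate m
      (convex hull (moment_curve ` T) :: (real ^ 'd::{finite,linorder}) set))))
    = card (simplex_moments T (real m))"
proof (rule bij_betw_same_card[where f = "moment_seq (real m)"])
  let ?L = "lattice_points (nonneg_part (dilate m (convex hull (moment_curve ` T) :: ((real, 'd) vec) set)))"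
  have L: "x \<in> ?L \<longleftrightarrow> moment_seq (real m) x \<in> simplex_moments T (real m)" for x
  proof -
    have "(\<forall>i. x $ i \<in> \<int>) \<longleftrightarrow> range (moment_seq (real m) x) \<subseteq> \<int>"
    proof
      assume "range (moment_seq (real m) x) \<subseteq> \<int>"
      then show "\<forall>i. x $ i \<in> \<int>" by (metis moment_seq_coord rangeI subsetD)
    qed (auto simp: moment_seq_def)
    moreover have "\<forall>n\<ge>card T. moment_seq (real m) x n = 0"
      using T by (simp add: moment_seq_def)
    ultimately show ?thesis
      by (auto simp: lattice_points_def mem_nonneg_part_iff[OF T m] simplex_moments_def int_moments_def)
  qed
  have "\<exists>x :: (real, 'd) vec. y = moment_seq (real m) x" if "y \<in> simplex_moments T (real m)" for y
  proof -
    have "y n = moment_seq (real m) (\<chi> i :: 'd. y (coord i)) n" for n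
    proof (cases "n \<le> CARD('d)")
      case True
      then show ?thesis
        using that by (cases rule: coord_cases[where 'd='d]) (auto simp: simplex_moments_def int_moments_def)
    next
      case False
      then show ?thesis
        using that T by (auto simp: simplex_moments_def int_moments_def moment_seq_def)
    qed
    then have "y = moment_seq (real m) (\<chi> i :: 'd. y (coord i))" by (rule ext)
    then show ?thesis by (rule exI)
  qed
  moreover have "inj (moment_seq (real m) :: (real, 'd) vec \<Rightarrow> _)"
    by (rule injI) (metis moment_seq_coord vec_eq_iff)
  ultimately show "bij_betw (moment_seq (real m)) ?L (simplex_moments T (real m))"
    unfolding bij_betw_def using L by (auto intro: inj_on_subset)
qed

section \<open>Volume of the simplex\<close>

lemma enumerate_finite_set:
  fixes T :: "'a::linorder set"
  assumes "finite T" "card T = Suc n"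
  obtains t where "strict_mono_on {..n} t" "T = t ` {..n}"
proof
  let ?xs = "sorted_list_of_set T"
  have len: "length ?xs = Suc n" using assms by simp
  show "strict_mono_on {..n} ((!) ?xs)"
    by (rule strict_mono_onI)
      (use len strict_sorted_list_of_set[of T] in \<open>auto intro: sorted_wrt_nth_less\<close>)
  have "T = set ?xs" using assms by simp
  also have "\<dots> = (!) ?xs ` {..<length ?xs}" by (auto simp only: set_conv_nth)
  finally show "T = (!) ?xs ` {..n}" unfolding len lessThan_Suc_atMost .
qed

lemma inj_moment_curve: "inj (moment_curve :: real \<Rightarrow> real ^ 'd::{finite,linorder})"
proof (rule injI)
  fix a b assume eq: "moment_curve a = (moment_curve b :: (real, 'd) vec)"
  have "1 \<le> CARD('d)" by (simp add: Suc_le_eq)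
  then obtain i :: 'd where i: "coord i = 1"
    by (cases rule: coord_cases[where 'd = 'd]) auto
  have "(moment_curve x :: (real, 'd) vec) $ i = x" for x
    using i by (simp add: moment_curve_def coord_def)
  from this[of a] this[of b] show "a = b" unfolding eq by simp
qed

text \<open>Constant terms cancel in the difference, leaving only the exponents
  \<open>1, ..., d\<close> of the coordinates.\<close>

lemma poly_eq_sum_coord:
  fixes p :: "real poly"
  assumes "degree p \<le> CARD('d::{finite,linorder})"
  shows "poly p a - poly p b = (\<Sum>i\<in>(UNIV :: 'd set). coeff p (coord i) * (a ^ coord i - b ^ coord i))"
proof -
  have *: "poly p x = coeff p 0 + (\<Sum>i\<in>(UNIV :: 'd set). coeff p (coord i) * x ^ coord i)" for x
  proof -
    have "poly p x = (\<Sum>n\<le>CARD('d). coeff p n * x ^ n)"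
      using moment_functional_eq[OF assms, of "\<lambda>n. x ^ n"] by (simp add: moment_functional_power)
    also have "{..CARD('d)} = insert 0 {1..CARD('d)}" by auto
    also have "(\<Sum>n\<in>\<dots>. coeff p n * x ^ n) = coeff p 0 + (\<Sum>n\<in>{1..CARD('d)}. coeff p n * x ^ n)"
      by simp
    also have "(\<Sum>n\<in>{1..CARD('d)}. coeff p n * x ^ n) = (\<Sum>i\<in>(UNIV :: 'd set). coeff p (coord i) * x ^ coord i)"
      by (rule sum.reindex_bij_betw[OF bij_betw_coord, symmetric])
    finally show ?thesis .
  qed
  show ?thesis
    unfolding *[of a] *[of b] by (simp add: sum_subtractf right_diff_distrib)
qed

lemma det_moment_curve:
  fixes t :: "nat \<Rightarrow> real"
  shows "det ((\<chi> i j. t (coord j) ^ coord i - t 0 ^ coord i) :: real ^ 'd::{finite,wellorder} ^ 'd::{finite,wellorder})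
    = (\<Prod>k\<le>CARD('d::{finite,wellorder}). \<Prod>i<k. t k - t i)"
proof -
  \<comment> \<open>Passing from monomials to the Newton polynomials \<open>N k\<close> triangularises the matrix.\<close>
  define N where "N k = (\<Prod>i<k. [:- t i, 1:])" for k
  define M where "M = ((\<chi> i j. t (coord j) ^ coord i - t 0 ^ coord i) :: ((real, 'd) vec, 'd) vec)"
  define U where "U = ((\<chi> k i. coeff (N (coord k)) (coord i)) :: ((real, 'd) vec, 'd) vec)"
  have deg: "degree (N k) = k" and lead: "coeff (N k) k = 1" for k
    using prod_linear_monic[of "\<lambda>i. - t i" "{..<k}"] by (simp_all add: N_def)
  have polyN: "poly (N k) x = (\<Prod>i<k. x - t i)" for k x
    by (simp add: N_def poly_prod)
  have UM: "(U ** M) $ k $ j = (\<Prod>i<coord k. t (coord j) - t i)" for k j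
  proof -
    have "(U ** M) $ k $ j = poly (N (coord k)) (t (coord j)) - poly (N (coord k)) (t 0)"
      using coord_range(2)[of k]
      by (simp add: matrix_matrix_mult_def U_def M_def poly_eq_sum_coord[where 'd = 'd] deg)
    also have "poly (N (coord k)) (t 0) = 0"
      using coord_range(1)[of k] by (auto simp: polyN prod_zero_iff)
    finally show ?thesis by (simp add: polyN)
  qed
  have "det U = (\<Prod>k\<in>UNIV. U $ k $ k)"
    by (rule det_lowerdiagonal) (simp add: U_def coeff_eq_0 deg)
  also have "\<dots> = 1" by (simp add: U_def lead)
  finally have detU: "det U = 1" .
  \<comment> \<open>For \<open>j < k\<close> the product contains the zero factor with
    \<open>i = coord j\<close>, so the matrix is upper triangular.\<close>
  have "det (U ** M) = (\<Prod>k\<in>UNIV. (U ** M) $ k $ k)"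
    by (rule det_upperdiagonal) (auto simp: UM prod_zero_iff)
  also have "\<dots> = (\<Prod>k\<in>{1..CARD('d)}. \<Prod>i<k. t k - t i)"
    unfolding UM by (rule prod.reindex_bij_betw[OF bij_betw_coord])
  also have "\<dots> = (\<Prod>k\<le>CARD('d). \<Prod>i<k. t k - t i)"
    by (rule prod.mono_neutral_left) (auto simp: Suc_le_eq)
  finally show ?thesis
    using detU by (simp add: det_mul M_def)
qed

lemma measure_moment_simplex_wellorder:
  assumes T: "finite T" "card T = Suc CARD('d::{finite,wellorder})"
  shows "measure lebesgue (convex hull (moment_curve ` T) :: ((real, 'd) vec) set)
    = vandermonde T / fact CARD('d)"
proof -
  obtain t where t: "strict_mono_on {..CARD('d)} t" "T = t ` {..CARD('d)}"
    using enumerate_finite_set[OF T] by blast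
  have inj: "inj_on t {..CARD('d)}" using t(1) by (rule strict_mono_on_imp_inj_on)
  let ?X = "moment_curve ` T :: (real, 'd) vec set"
  have X: "finite ?X" "card ?X = Suc CARD('d)" "moment_curve (t 0) \<in> ?X"
    using T t inj_moment_curve[where 'd = 'd] by (auto simp: card_image inj_on_subset)
  \<comment> \<open>The volume formula takes the edges from one base vertex, here the one at
    \<open>t 0\<close>; the other vertices are labelled by the coordinates.\<close>
  have bij: "bij_betw (\<lambda>i :: 'd. moment_curve (t (coord i)) :: (real, 'd) vec) UNIV (?X - {moment_curve (t 0)})"
  proof (rule bij_betw_imageI)
    show "inj (\<lambda>i :: 'd. moment_curve (t (coord i)) :: (real, 'd) vec)"
    proof (rule injI)
      fix i j :: 'd
      assume "moment_curve (t (coord i)) = (moment_curve (t (coord j)) :: (real, 'd) vec)"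
      then have "t (coord i) = t (coord j)" by (simp only: inj_eq[OF inj_moment_curve])
      then have "coord i = coord j" by (rule inj_onD[OF inj]) (simp_all add: coord_range)
      then show "i = j" by simp
    qed
    have "range (\<lambda>i :: 'd. moment_curve (t (coord i)) :: (real, 'd) vec)
        = moment_curve ` t ` range (coord :: 'd \<Rightarrow> nat)" by auto
    also have "range (coord :: 'd \<Rightarrow> nat) = {..CARD('d)} - {0}"
      using bij_betw_imp_surj_on[OF bij_betw_coord[where 'd = 'd]] by auto
    also have "t ` ({..CARD('d)} - {0}) = T - {t 0}"
      using inj by (simp add: inj_on_image_set_diff[of t "{..CARD('d)}"] t(2))
    also have "moment_curve ` (T - {t 0}) = ?X - {moment_curve (t 0)}"
      by (simp add: image_set_diff[OF inj_moment_curve])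
    finally show "range (\<lambda>i :: 'd. moment_curve (t (coord i)) :: (real, 'd) vec) = ?X - {moment_curve (t 0)}" .
  qed
  have "measure lebesgue (convex hull ?X) = measure lborel (convex hull ?X)"
    using compact_imp_closed[OF finite_imp_compact_convex_hull[OF X(1)]]
    by (intro measure_completion) simp
  also have "\<dots> = \<bar>det (\<chi> (i :: 'd) (j :: 'd). (moment_curve (t (coord j)) :: (real, 'd) vec) $ i
      - (moment_curve (t 0) :: (real, 'd) vec) $ i)\<bar> / fact CARD('d)"
    by (rule content_simplex[OF X bij])
  also have "(\<chi> i j :: 'd. (moment_curve (t (coord j)) :: (real, 'd) vec) $ i
      - (moment_curve (t 0) :: (real, 'd) vec) $ i)
      = (\<chi> i j. t (coord j) ^ coord i - t 0 ^ coord i)"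
    by (simp add: moment_curve_def coord_def)
  also have "det \<dots> = vandermonde T"
    unfolding det_moment_curve t(2) by (rule vandermonde_image[OF t(1), symmetric])
  finally show ?thesis by (simp add: vandermonde_def prod_nonneg)
qed

text \<open>
  The determinant and volume lemmas of the library ask for an index type of class
  \<^class>\<open>wellorder\<close>, which is not derivable for a type variable of sort
  \<open>{finite,linorder}\<close>, although every such type is well-ordered. The copy below carries that
  instance.
\<close>

typedef 'a wo_copy = "UNIV :: 'a set" ..

lemma bij_Rep_wo_copy: "bij Rep_wo_copy"
  by (rule bij_betwI[where g = Abs_wo_copy]) (simp_all add: Rep_wo_copy_inverse Abs_wo_copy_inverse)

instance wo_copy :: (finite) finite
proof
  show "finite (UNIV :: 'a wo_copy set)"
    using bij_betw_finite[OF bij_Rep_wo_copy[where 'a = 'a]] by simp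
qed

instantiation wo_copy :: (linorder) linorder
begin

definition "x \<le> y \<longleftrightarrow> Rep_wo_copy x \<le> Rep_wo_copy y"
definition "x < y \<longleftrightarrow> Rep_wo_copy x < Rep_wo_copy y"

instance
  by standard (auto simp: less_eq_wo_copy_def less_wo_copy_def less_le Rep_wo_copy_inject)

end

instance wo_copy :: ("{finite,linorder}") wellorder
proof
  fix P :: "'a wo_copy \<Rightarrow> bool" and a
  assume "\<And>x. (\<And>y. y < x \<Longrightarrow> P y) \<Longrightarrow> P x"
  \<comment> \<open>\<open>coord\<close> is strictly increasing into the natural numbers, so
    induction on its value applies.\<close>
  then show "P a" by (induction a rule: measure_induct_rule[where f = coord]) simp
qed

lemma CARD_wo_copy [simp]: "CARD('a wo_copy) = CARD('a)"
  using bij_betw_same_card[OF bij_Rep_wo_copy[where 'a = 'a]] .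

lemma coord_Rep_wo_copy: "coord (Rep_wo_copy i) = coord (i :: 'a::{finite,linorder} wo_copy)"
proof -
  have "bij_betw Rep_wo_copy {..i} {..Rep_wo_copy i}"
    by (rule bij_betwI[where g = Abs_wo_copy])
      (simp_all add: Rep_wo_copy_inverse Abs_wo_copy_inverse less_eq_wo_copy_def)
  then show ?thesis unfolding coord_def by (rule bij_betw_same_card[symmetric])
qed

section \<open>Invariance of the measure under relabelling of coordinates\<close>

lemma prod_Basis_vec: "(\<Prod>b\<in>Basis. (x :: real ^ 'n) \<bullet> b) = (\<Prod>i\<in>UNIV. x $ i)"
proof -
  have Basis: "(Basis :: (real, 'n) vec set) = range (\<lambda>i. axis i 1)" by (auto simp: Basis_vec_def)
  have inj: "inj (\<lambda>i :: 'n. axis i (1 :: real))" by (auto simp: inj_def axis_eq_axis)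
  show ?thesis unfolding Basis prod.reindex[OF inj] by (simp add: inner_axis)
qed

text \<open>Lebesgue measure is determined by its values on boxes, and the preimage of a box is a
  box with the same side lengths in another order.\<close>

lemma lborel_distr_reindex:
  fixes f :: "'n::finite \<Rightarrow> 'k::finite"
  assumes "bij f"
  shows "lborel = distr lborel borel (\<lambda>x :: real ^ 'k. \<chi> i. x $ f i)"
proof (rule lborel_eqI)
  let ?r = "\<lambda>x :: (real, 'k) vec. (\<chi> i. x $ f i) :: (real, 'n) vec"
  have meas: "?r \<in> borel_measurable borel"
    by (intro borel_measurable_continuous_onI continuous_intros)
  fix l u :: "(real, 'n) vec"
  assume *: "\<And>b. b \<in> Basis \<Longrightarrow> l \<bullet> b \<le> u \<bullet> b"
  have le: "l $ i \<le> u $ i" for i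
    using *[of "axis i 1"] by (simp add: inner_axis axis_in_Basis_iff)
  let ?l = "(\<chi> k. l $ inv f k) :: (real, 'k) vec" and ?u = "(\<chi> k. u $ inv f k) :: (real, 'k) vec"
  have inv: "inv f (f i) = i" "f (inv f k) = k" for i k
    using assms by (simp_all add: bij_is_inj bij_is_surj surj_f_inv_f)
  have all_inv: "(\<forall>k. P (inv f k) k) \<longleftrightarrow> (\<forall>i. P i (f i))" for P
    using inv by metis
  have "?r -` box l u = box ?l ?u"
  proof (rule set_eqI)
    fix x show "x \<in> ?r -` box l u \<longleftrightarrow> x \<in> box ?l ?u"
      using all_inv[of "\<lambda>i k. l $ i < x $ k \<and> x $ k < u $ i"] by (simp add: mem_box_cart)
  qed
  then have "emeasure (distr lborel borel ?r) (box l u) = emeasure lborel (box ?l ?u)"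
    using meas by (subst emeasure_distr) auto
  also have "\<dots> = (\<Prod>b\<in>Basis. (?u - ?l) \<bullet> b)"
    using le by (subst emeasure_lborel_box_eq) (auto simp: Basis_vec_def inner_axis)
  also have "\<dots> = (\<Prod>k\<in>UNIV. (u - l) $ inv f k)"
    by (simp add: prod_Basis_vec)
  also have "\<dots> = (\<Prod>i\<in>UNIV. (u - l) $ i)"
    using prod.reindex_bij_betw[OF bij_imp_bij_inv[OF assms], of "\<lambda>i. (u - l) $ i"] by simp
  finally show "emeasure (distr lborel borel ?r) (box l u) = (\<Prod>b\<in>Basis. (u - l) \<bullet> b)"
    by (simp only: prod_Basis_vec)
qed simp

lemma measure_lebesgue_reindex:
  fixes f :: "'n::finite \<Rightarrow> 'k::finite" and S :: "(real ^ 'k) set"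
  assumes "bij f" "compact S"
  shows "measure lebesgue ((\<lambda>x. (\<chi> i. x $ f i) :: real ^ 'n) ` S) = measure lebesgue S"
proof -
  let ?r = "\<lambda>x :: (real, 'k) vec. (\<chi> i. x $ f i) :: (real, 'n) vec"
  have cont: "continuous_on A ?r" for A by (intro continuous_intros)
  have "inj ?r"
  proof (rule injI)
    fix x y assume "?r x = ?r y"
    then have "x $ f i = y $ f i" for i by (simp add: vec_eq_iff)
    then have "x $ k = y $ k" for k using surjD[OF bij_is_surj[OF assms(1)], of k] by auto
    then show "x = y" by (simp add: vec_eq_iff)
  qed
  have "compact (?r ` S)" using cont assms(2) by (rule compact_continuous_image)
  then have borel: "?r ` S \<in> sets borel" "S \<in> sets borel"
    using assms(2) by (auto dest: compact_imp_closed)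
  then have "measure lebesgue (?r ` S) = measure lborel (?r ` S)"
    by (intro measure_completion) auto
  also have "\<dots> = measure (distr lborel borel ?r) (?r ` S)"
    by (subst lborel_distr_reindex[OF assms(1)]) (rule refl)
  also have "\<dots> = measure lborel (?r -` ?r ` S)"
    using borel borel_measurable_continuous_onI[OF cont] by (subst measure_distr) auto
  also have "\<dots> = measure lebesgue S"
    using borel \<open>inj ?r\<close> by (simp add: inj_vimage_image_eq measure_completion)
  finally show ?thesis .
qed

text \<open>Relabelling from the well-ordered copy keeps positions, so it maps moment curve to
  moment curve, and being linear it commutes with convex hulls.\<close>

lemma measure_moment_simplex:
  assumes T: "finite T" "card T = Suc CARD('d::{finite,linorder})"
  shows "measure lebesgue (convex hull (moment_curve ` T) :: ((real, 'd) vec) set)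
    = vandermonde T / fact CARD('d)"
proof -
  have bij: "bij (inv Rep_wo_copy :: 'd \<Rightarrow> 'd wo_copy)"
    by (rule bij_imp_bij_inv[OF bij_Rep_wo_copy])
  let ?r = "\<lambda>x :: (real, 'd wo_copy) vec. (\<chi> i. x $ inv Rep_wo_copy i) :: (real, 'd) vec"
  have "?r (moment_curve s) = moment_curve s" for s
  proof -
    have "coord (inv Rep_wo_copy i :: 'd wo_copy) = coord i" for i
      using coord_Rep_wo_copy[of "inv Rep_wo_copy i"]
      by (simp add: surj_f_inv_f[OF bij_is_surj[OF bij_Rep_wo_copy]])
    then show ?thesis by (simp add: moment_curve_def vec_eq_iff flip: coord_def)
  qed
  moreover have "linear ?r" by (rule linearI) (simp_all add: vec_eq_iff)
  ultimately have "(convex hull (moment_curve ` T) :: (real, 'd) vec set)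
      = ?r ` (convex hull (moment_curve ` T))"
    by (simp add: convex_hull_linear_image image_image)
  also have "measure lebesgue \<dots> = measure lebesgue (convex hull (moment_curve ` T) :: (real, 'd wo_copy) vec set)"
    using T bij by (intro measure_lebesgue_reindex finite_imp_compact_convex_hull) auto
  also have "\<dots> = vandermonde T / fact CARD('d)"
    using T by (simp add: measure_moment_simplex_wellorder)
  finally show ?thesis .
qed

theorem theorem2p9:
  fixes T :: "int set" and m :: nat
  assumes "card T = CARD('d::{finite,linorder}) + 1"
    and "m > 0"
  shows "measure lebesgue (dilate m (cyclic_polytope T :: (real ^ 'd::{finite,linorder}) set)) =
         real (card (lattice_points (nonneg_part (dilate m (cyclic_polytope T :: (real ^ 'd::{finite,linorder}) set)))))"
proof -
  define S where "S = real_of_int ` T"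
  \<comment> \<open>Infinite sets have \<open>card\<close> 0, so a positive cardinality forces
    finiteness.\<close>
  have "finite T" using assms(1) by (metis Suc_eq_plus1 card.infinite zero_neq_one add_is_0)
  then have S: "finite S" "card S = Suc CARD('d)" "S \<subseteq> \<int>"
    using assms(1) by (auto simp: S_def card_image inj_on_def)
  have P: "cyclic_polytope T = (convex hull (moment_curve ` S) :: (real, 'd) vec set)"
    by (simp add: cyclic_polytope_def S_def image_image)
  \<comment> \<open>Volume and count meet at the Vandermonde product times
    \<open>m ^ d / d!\<close>: the first by scaling, the second by the inductive count.\<close>
  have "measure lebesgue (dilate m (cyclic_polytope T :: (real, 'd) vec set))
      = real m ^ CARD('d) * measure lebesgue (cyclic_polytope T :: (real, 'd) vec set)"
    using measure_lebesgue_affine[of "real m" "0 :: (real, 'd) vec"] by (simp add: dilate_def)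
  also have "\<dots> = vandermonde S * real m ^ CARD('d) / fact CARD('d)"
    unfolding P measure_moment_simplex[OF S(1,2)] by simp
  also have "\<dots> = real (card (simplex_moments S (real m)))"
    using card_simplex_moments[OF S(1,3,2), of "real m"] assms(2) by simp
  also have "\<dots> = real (card (lattice_points (nonneg_part (dilate m (cyclic_polytope T :: (real, 'd) vec set)))))"
    unfolding P card_lattice_points_nonneg_part[OF S(1,2) assms(2)] ..
  finally show ?thesis .
qed

end
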